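(* Let $\phi:\mathcal H\to\mathbb R\cup\{+\infty\}$ be a proper lower semicontinuous convex function with $\operatorname{argmin}\phi\neq\emptyset$, and let $\alpha>3$, $\beta>0$, $t_0>0$. Let $(x,y):[t_0,+\infty[\to\mathcal H\times\mathcal H$ be the global strong solution of the system $$\left\{\begin{array}{rcl}\dot x(t)+\beta\partial\phi(x(t))-\left(\frac1\beta-\frac{\alpha}{t}\right)x(t)+\frac1\beta y(t)&\ni&0\\[2mm] \dot y(t)-\left(\frac1\beta-\frac{\alpha}{t}+\frac{\alpha\beta}{t^2}\right)x(t)+\frac1\beta y(t)&=&0\end{array}\right.$$ with initial value $(x(t_0),y(t_0))=(x_0,y_0)\in\operatorname{dom}\phi\times\mathcal H$. Then $x(t)$ converges weakly, as $t\to+\infty$, to a point in $\operatorname{argmin}\phi$.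
   Context: $\mathcal H$ is a real Hilbert space; $\partial\phi$ is the convex subdifferential; $\operatorname{dom}\phi=\{x:\phi(x)<+\infty\}$ and $\operatorname{dom}(\partial\phi)=\{x:\partial\phi(x)\neq\emptyset\}$. Strong solution: $(x,y)$ is a global strong solution of the system if for every $T>t_0$ it is continuous on $[t_0,T]$, absolutely continuous on every compact subset of $]t_0,T]$, $x(t)\in\operatorname{dom}(\partial\phi)$ for almost every $t\in]t_0,T]$, and both relations of the system hold for almost every $t\in]t_0,T]$. For every initial datum in $\operatorname{dom}\phi\times\mathcal H$ there is a unique such solution. *)

theory Defs
  imports "HOL-Analysis.Analysis"
begin

text \<open>
  Functions with values in the reals extended by plus infinity are rendered as
  \<open>ereal\<close>-valued functions; \<open>proper\<close> excludes the value \<open>-\<infinity>\<close>.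
  A real Hilbert space is a type of class \<open>{real_inner, complete_space}\<close>.
\<close>

definition edom :: "('a \<Rightarrow> ereal) \<Rightarrow> 'a set" where
  "edom \<phi> = {x. \<phi> x < \<infinity>}"

definition proper :: "('a \<Rightarrow> ereal) \<Rightarrow> bool" where
  "proper \<phi> \<longleftrightarrow> (\<forall>x. \<phi> x \<noteq> -\<infinity>) \<and> edom \<phi> \<noteq> {}"

definition lsc :: "('a::topological_space \<Rightarrow> ereal) \<Rightarrow> bool" where
  "lsc \<phi> \<longleftrightarrow> (\<forall>x. \<phi> x \<le> Liminf (at x) \<phi>)"

text \<open>
  Meant for functions that avoid \<open>-\<infinity>\<close>. The weights are taken in the open interval,
  so no product of \<open>0\<close> and \<open>\<infinity>\<close> arises.
\<close>

definition econvex :: "('a::real_vector \<Rightarrow> ereal) \<Rightarrow> bool" where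
  "econvex \<phi> \<longleftrightarrow> (\<forall>x y. \<forall>u\<in>{0<..<1}.
     \<phi> ((1 - u) *\<^sub>R x + u *\<^sub>R y) \<le> ereal (1 - u) * \<phi> x + ereal u * \<phi> y)"

definition argmin_set :: "('a \<Rightarrow> ereal) \<Rightarrow> 'a set" where
  "argmin_set \<phi> = {x. is_arg_min \<phi> (\<lambda>_. True) x}"

text \<open>For proper \<open>\<phi>\<close> the subdifferential is empty outside \<open>edom \<phi>\<close>.\<close>

definition subdifferential :: "('a::real_inner \<Rightarrow> ereal) \<Rightarrow> 'a \<Rightarrow> 'a set" where
  "subdifferential \<phi> x = {p. \<forall>y. \<phi> x + ereal (p \<bullet> (y - x)) \<le> \<phi> y}"

definition dom_subdifferential :: "('a::real_inner \<Rightarrow> ereal) \<Rightarrow> 'a set" where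
  "dom_subdifferential \<phi> = {x. subdifferential \<phi> x \<noteq> {}}"

text \<open>
  Absolute continuity of a vector-valued function on an arbitrary set \<open>S\<close> of reals: the
  \<open>\<epsilon>\<close>-\<open>\<delta>\<close> condition over finite families of non-overlapping intervals with endpoints
  in \<open>S\<close>, a family being a finite set of pairs (left endpoint, right endpoint).
\<close>

definition abs_continuous_on :: "real set \<Rightarrow> (real \<Rightarrow> 'a::metric_space) \<Rightarrow> bool" where
  "abs_continuous_on S f \<longleftrightarrow>
     (\<forall>\<epsilon>>0. \<exists>\<delta>>0. \<forall>D :: (real \<times> real) set.
        finite D \<and> (\<forall>(a, b)\<in>D. a \<in> S \<and> b \<in> S \<and> a \<le> b) \<and>
        disjoint_family_on (\<lambda>(a, b). {a<..<b}) D \<and> (\<Sum>(a, b)\<in>D. b - a) < \<delta>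
        \<longrightarrow> (\<Sum>(a, b)\<in>D. dist (f a) (f b)) < \<epsilon>)"

text \<open>
  Trajectories are total functions on the reals of which only the restriction to
  \<open>{t0..}\<close> is relevant. The first relation is the inclusion
  \<open>0 \<in> x'(t) + \<beta> \<partial>\<phi>(x(t)) - (1/\<beta> - \<alpha>/t) x(t) + (1/\<beta>) y(t)\<close>.
\<close>

definition system_holds_at ::
  "('a::real_inner \<Rightarrow> ereal) \<Rightarrow> real \<Rightarrow> real \<Rightarrow> (real \<Rightarrow> 'a) \<Rightarrow> (real \<Rightarrow> 'a) \<Rightarrow> real \<Rightarrow> bool" where
  "system_holds_at \<phi> \<alpha> \<beta> x y t \<longleftrightarrow>
     (\<exists>x' y'. (x has_vector_derivative x') (at t) \<and> (y has_vector_derivative y') (at t) \<and>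
        0 \<in> (\<lambda>\<xi>. x' + \<beta> *\<^sub>R \<xi> - (1 / \<beta> - \<alpha> / t) *\<^sub>R x t + (1 / \<beta>) *\<^sub>R y t)
               ` subdifferential \<phi> (x t) \<and>
        y' - (1 / \<beta> - \<alpha> / t + \<alpha> * \<beta> / t\<^sup>2) *\<^sub>R x t + (1 / \<beta>) *\<^sub>R y t = 0)"

definition global_strong_solution ::
  "('a::real_inner \<Rightarrow> ereal) \<Rightarrow> real \<Rightarrow> real \<Rightarrow> real \<Rightarrow> (real \<Rightarrow> 'a) \<Rightarrow> (real \<Rightarrow> 'a) \<Rightarrow> bool" where
  "global_strong_solution \<phi> \<alpha> \<beta> t0 x y \<longleftrightarrow>
     (\<forall>T>t0.
        continuous_on {t0..T} (\<lambda>t. (x t, y t)) \<and>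
        (\<forall>K. compact K \<and> K \<subseteq> {t0<..T} \<longrightarrow> abs_continuous_on K (\<lambda>t. (x t, y t))) \<and>
        (AE t in lebesgue. t \<in> {t0<..T} \<longrightarrow> x t \<in> dom_subdifferential \<phi>) \<and>
        (AE t in lebesgue. t \<in> {t0<..T} \<longrightarrow> system_holds_at \<phi> \<alpha> \<beta> x y t))"

text \<open>Weak convergence in a Hilbert space, tested against all vectors.\<close>

definition weakly_tendsto :: "('b \<Rightarrow> 'a::real_inner) \<Rightarrow> 'a \<Rightarrow> 'b filter \<Rightarrow> bool" where
  "weakly_tendsto f l F \<longleftrightarrow> (\<forall>v. ((\<lambda>t. f t \<bullet> v) \<longlongrightarrow> l \<bullet> v) F)"

end

theory Submission
  imports Defs
begin

text \<open>
  Put \<open>u = (1/\<beta> - \<alpha>/t) x - y/\<beta>\<close>. Then \<open>u = x' + \<beta>\<xi>\<close> and \<open>u' = -(\<alpha>/t) x' - \<xi>\<close> almost everywhere, with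
  \<open>\<xi>\<close> in the subdifferential of \<open>\<phi>\<close> at \<open>x\<close>. For \<open>z\<close> in \<open>argmin \<phi>\<close> and \<open>2 < \<mu> < \<alpha> - 1\<close> the energy
  \<open>t(t + \<beta>(\<alpha> - 2 - \<mu>))(\<phi>(x) - min \<phi>) + \<parallel>\<mu>(x - z) + t u\<parallel>\<^sup>2/2 + \<mu>(\<alpha> - 1 - \<mu>)\<parallel>x - z\<parallel>\<^sup>2/2\<close>
  is eventually nonincreasing. It is affine in \<open>\<mu>\<close>, so two values of \<open>\<mu>\<close> give the convergence of
  \<open>t (x - z) \<bullet> u + (\<alpha> - 1)\<parallel>x - z\<parallel>\<^sup>2/2\<close>. If \<open>Q' = (x - z) \<bullet> u\<close>, then \<open>P = Q - \<parallel>x - z\<parallel>\<^sup>2/2\<close> is monotone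
  and bounded, so \<open>t Q' + (\<alpha> - 1) Q\<close> converges, hence so does \<open>Q\<close> by l'Hospital's rule, and
  \<open>\<parallel>x - z\<parallel>\<close> converges. Opial's lemma concludes.

  A strong solution is only absolutely continuous, so the chain rule for \<open>\<phi>(x(t))\<close> is not immediate.
  Monotonicity and Gronwall's inequality show that \<open>x\<close> is locally Lipschitz; then \<open>\<xi>\<close> is locally bounded
  and \<open>\<phi>(x(t))\<close> is locally Lipschitz. Only upper bounds for the derivative of the energy are needed, and
  they follow from the subgradient inequality without differentiating \<open>\<phi>(x(t))\<close>.
\<close>

section \<open>Absolutely continuous functions\<close>

lemma abs_continuous_onE:
  assumes "abs_continuous_on S f" and "\<epsilon> > 0"
  obtains \<delta> where "\<delta> > 0" and "\<And>D. finite D \<Longrightarrow> (\<forall>(a, b)\<in>D. a \<in> S \<and> b \<in> S \<and> a \<le> b) \<Longrightarrow>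
    disjoint_family_on (\<lambda>(a, b). {a<..<b}) D \<Longrightarrow> (\<Sum>(a, b)\<in>D. b - a) < \<delta> \<Longrightarrow>
    (\<Sum>(a, b)\<in>D. dist (f a) (f b)) < \<epsilon>"
proof -
  from assms(1)[unfolded abs_continuous_on_def, rule_format, OF assms(2)] obtain \<delta>
    where "\<delta> > 0" and *: "\<forall>D. finite D \<and> (\<forall>(a, b)\<in>D. a \<in> S \<and> b \<in> S \<and> a \<le> b) \<and>
      disjoint_family_on (\<lambda>(a, b). {a<..<b}) D \<and> (\<Sum>(a, b)\<in>D. b - a) < \<delta> \<longrightarrow>
      (\<Sum>(a, b)\<in>D. dist (f a) (f b)) < \<epsilon>"
    by (elim exE conjE)
  show ?thesis
    by (rule that[OF \<open>\<delta> > 0\<close>], rule *[THEN spec, THEN mp], intro conjI)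
qed

lemma abs_continuous_on_lipschitz:
  fixes f :: "real \<Rightarrow> 'a::metric_space"
  assumes "\<And>s t. s \<in> S \<Longrightarrow> t \<in> S \<Longrightarrow> s \<le> t \<Longrightarrow> dist (f s) (f t) \<le> L * (t - s)"
  shows "abs_continuous_on S f"
  unfolding abs_continuous_on_def
proof (intro allI impI)
  fix \<epsilon> :: real assume "\<epsilon> > 0"
  \<comment> \<open>\<open>L\<close> may be zero or negative; \<open>M\<close> dominates it and is
    positive, so it can be divided by.\<close>
  define M where "M = \<bar>L\<bar> + 1"
  have "M > 0" by (simp add: M_def)
  show "\<exists>\<delta>>0. \<forall>D. finite D \<and> (\<forall>(a, b)\<in>D. a \<in> S \<and> b \<in> S \<and> a \<le> b) \<and>
        disjoint_family_on (\<lambda>(a, b). {a<..<b}) D \<and> (\<Sum>(a, b)\<in>D. b - a) < \<delta>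
        \<longrightarrow> (\<Sum>(a, b)\<in>D. dist (f a) (f b)) < \<epsilon>"
  proof (intro exI conjI allI impI)
    show "\<epsilon> / M > 0" using \<open>\<epsilon> > 0\<close> \<open>M > 0\<close> by simp
    fix D :: "(real \<times> real) set"
    assume D: "finite D \<and> (\<forall>(a, b)\<in>D. a \<in> S \<and> b \<in> S \<and> a \<le> b) \<and>
        disjoint_family_on (\<lambda>(a, b). {a<..<b}) D \<and> (\<Sum>(a, b)\<in>D. b - a) < \<epsilon> / M"
    have "(\<Sum>(a, b)\<in>D. dist (f a) (f b)) \<le> (\<Sum>(a, b)\<in>D. M * (b - a))"
    proof (intro sum_mono, clarify)
      fix a b assume "(a, b) \<in> D"
      with D have ab: "a \<in> S" "b \<in> S" "a \<le> b" by auto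
      have "L * (b - a) \<le> M * (b - a)"
        using ab by (intro mult_right_mono) (auto simp: M_def)
      with assms[OF ab] show "dist (f a) (f b) \<le> M * (b - a)" by linarith
    qed
    also have "\<dots> = M * (\<Sum>(a, b)\<in>D. b - a)"
      by (simp add: sum_distrib_left case_prod_unfold)
    also have "\<dots> < \<epsilon>"
      using D \<open>M > 0\<close> by (simp add: pos_less_divide_eq mult.commute)
    finally show "(\<Sum>(a, b)\<in>D. dist (f a) (f b)) < \<epsilon>" .
  qed
qed

text \<open>The definition is applied to \<open>f\<close> and \<open>g\<close> with half of the
  rescaled tolerance each. Sums, differences and bilinear products below all reduce to this estimate
  of increments.\<close>

lemma abs_continuous_on_dominated2:
  fixes f :: "real \<Rightarrow> 'a::metric_space" and g :: "real \<Rightarrow> 'b::metric_space"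
    and h :: "real \<Rightarrow> 'c::metric_space"
  assumes f: "abs_continuous_on S f" and g: "abs_continuous_on S g"
    and dom: "\<And>s t. s \<in> S \<Longrightarrow> t \<in> S \<Longrightarrow> s \<le> t \<Longrightarrow> 
      dist (h s) (h t) \<le> K * (dist (f s) (f t) + dist (g s) (g t))"
  shows "abs_continuous_on S h"
  unfolding abs_continuous_on_def
proof (intro allI impI)
  fix \<epsilon> :: real assume "\<epsilon> > 0"
  define M where "M = \<bar>K\<bar> + 1"
  have "M > 0" by (simp add: M_def)
  then have e: "\<epsilon> / (2 * M) > 0" using \<open>\<epsilon> > 0\<close> by simp
  obtain \<delta>1 where d1: "\<delta>1 > 0" "\<And>D. finite D \<Longrightarrow> (\<forall>(a, b)\<in>D. a \<in> S \<and> b \<in> S \<and> a \<le> b) \<Longrightarrow>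
        disjoint_family_on (\<lambda>(a, b). {a<..<b}) D \<Longrightarrow> (\<Sum>(a, b)\<in>D. b - a) < \<delta>1
        \<Longrightarrow> (\<Sum>(a, b)\<in>D. dist (f a) (f b)) < \<epsilon> / (2 * M)"
    by (rule abs_continuous_onE[OF f e]) blast
  obtain \<delta>2 where d2: "\<delta>2 > 0" "\<And>D. finite D \<Longrightarrow> (\<forall>(a, b)\<in>D. a \<in> S \<and> b \<in> S \<and> a \<le> b) \<Longrightarrow>
        disjoint_family_on (\<lambda>(a, b). {a<..<b}) D \<Longrightarrow> (\<Sum>(a, b)\<in>D. b - a) < \<delta>2
        \<Longrightarrow> (\<Sum>(a, b)\<in>D. dist (g a) (g b)) < \<epsilon> / (2 * M)"
    by (rule abs_continuous_onE[OF g e]) blast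
  show "\<exists>\<delta>>0. \<forall>D. finite D \<and> (\<forall>(a, b)\<in>D. a \<in> S \<and> b \<in> S \<and> a \<le> b) \<and>
        disjoint_family_on (\<lambda>(a, b). {a<..<b}) D \<and> (\<Sum>(a, b)\<in>D. b - a) < \<delta>
        \<longrightarrow> (\<Sum>(a, b)\<in>D. dist (h a) (h b)) < \<epsilon>"
  proof (intro exI conjI allI impI)
    show "min \<delta>1 \<delta>2 > 0" using d1 d2 by simp
    fix D :: "(real \<times> real) set"
    assume D: "finite D \<and> (\<forall>(a, b)\<in>D. a \<in> S \<and> b \<in> S \<and> a \<le> b) \<and>
        disjoint_family_on (\<lambda>(a, b). {a<..<b}) D \<and> (\<Sum>(a, b)\<in>D. b - a) < min \<delta>1 \<delta>2"
    have "(\<Sum>(a, b)\<in>D. dist (h a) (h b)) \<le> (\<Sum>(a, b)\<in>D. M * (dist (f a) (f b) + dist (g a) (g b)))"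
    proof (intro sum_mono, clarify)
      fix a b assume "(a, b) \<in> D"
      with D have ab: "a \<in> S" "b \<in> S" "a \<le> b" by auto
      have "K * (dist (f a) (f b) + dist (g a) (g b)) \<le> M * (dist (f a) (f b) + dist (g a) (g b))"
        by (intro mult_right_mono) (auto simp: M_def)
      with dom[OF ab] show "dist (h a) (h b) \<le> M * (dist (f a) (f b) + dist (g a) (g b))" by linarith
    qed
    also have "\<dots> = M * ((\<Sum>(a, b)\<in>D. dist (f a) (f b)) + (\<Sum>(a, b)\<in>D. dist (g a) (g b)))"
      by (simp add: sum_distrib_left case_prod_unfold sum.distrib distrib_left)
    also have "\<dots> < M * (\<epsilon> / (2 * M) + \<epsilon> / (2 * M))"
      using D d1(2)[of D] d2(2)[of D] \<open>M > 0\<close> by (intro mult_strict_left_mono add_strict_mono) auto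
    also have "\<dots> = \<epsilon>" using \<open>M > 0\<close> by (simp add: field_simps)
    finally show "(\<Sum>(a, b)\<in>D. dist (h a) (h b)) < \<epsilon>" .
  qed
qed

lemma abs_continuous_on_dominated:
  assumes "abs_continuous_on S f"
    and "\<And>s t. s \<in> S \<Longrightarrow> t \<in> S \<Longrightarrow> s \<le> t \<Longrightarrow> dist (h s) (h t) \<le> K * dist (f s) (f t)"
  shows "abs_continuous_on S h"
proof (rule abs_continuous_on_dominated2[OF assms(1), of "\<lambda>_. 0 :: real"])
  show "abs_continuous_on S (\<lambda>_. 0 :: real)" by (rule abs_continuous_on_lipschitz[where L = 0]) simp
qed (use assms in auto)

lemma abs_continuous_on_imp_continuous_on:
  fixes f :: "real \<Rightarrow> 'a::metric_space"
  assumes "abs_continuous_on S f"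
  shows "continuous_on S f"
  unfolding continuous_on_iff
proof (intro ballI allI impI)
  fix x and e :: real assume "x \<in> S" "e > 0"
  obtain \<delta> where d: "\<delta> > 0" "\<And>D. finite D \<Longrightarrow> (\<forall>(a, b)\<in>D. a \<in> S \<and> b \<in> S \<and> a \<le> b) \<Longrightarrow>
        disjoint_family_on (\<lambda>(a, b). {a<..<b}) D \<Longrightarrow> (\<Sum>(a, b)\<in>D. b - a) < \<delta>
        \<Longrightarrow> (\<Sum>(a, b)\<in>D. dist (f a) (f b)) < e"
    by (rule abs_continuous_onE[OF assms \<open>e > 0\<close>]) blast
  \<comment> \<open>Families of one interval suffice; its orientation depends on which of the two
    points is smaller.\<close>
  have "dist (f x') (f x) < e" if "x' \<in> S" "dist x' x < \<delta>" for x'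
    using d(2)[of "{(x, x')}"] d(2)[of "{(x', x)}"] that \<open>x \<in> S\<close>
    by (cases "x \<le> x'") (auto simp: disjoint_family_on_def dist_real_def dist_commute)
  with d(1) show "\<exists>d>0. \<forall>x'\<in>S. dist x' x < d \<longrightarrow> dist (f x') (f x) < e" by blast
qed

lemma abs_continuous_on_subset:
  "abs_continuous_on S f \<Longrightarrow> T \<subseteq> S \<Longrightarrow> abs_continuous_on T f"
  unfolding abs_continuous_on_def
  apply (erule all_forward)
  apply (erule imp_forward, assumption)
  apply (erule ex_forward)
  apply (erule conj_forward, assumption)
  apply (erule all_forward)
  apply (erule imp_forward)
   apply fast
  apply assumption
  done

text \<open>Serves to compare \<open>x\<close> with its translates. Translation preserves the
  lengths and the disjointness of the intervals of a family.\<close>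

lemma abs_continuous_on_shift:
  assumes "abs_continuous_on {a + h..b + h} f"
  shows "abs_continuous_on {a..b} (\<lambda>t. f (t + h :: real))"
  unfolding abs_continuous_on_def
proof (intro allI impI)
  fix e :: real assume "e > 0"
  obtain \<delta> where d: "\<delta> > 0" "\<And>D. finite D \<Longrightarrow> (\<forall>(c, d)\<in>D. c \<in> {a+h..b+h} \<and> d \<in> {a+h..b+h} \<and> c \<le> d) \<Longrightarrow>
        disjoint_family_on (\<lambda>(a, b). {a<..<b}) D \<Longrightarrow> (\<Sum>(a, b)\<in>D. b - a) < \<delta>
        \<Longrightarrow> (\<Sum>(a, b)\<in>D. dist (f a) (f b)) < e"
    by (rule abs_continuous_onE[OF assms \<open>e > 0\<close>]) blast
  let ?s = "\<lambda>(c, d). (c + h, d + h)"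
  have inj: "inj_on ?s D" for D by (auto simp: inj_on_def)
  show "\<exists>\<delta>>0. \<forall>D. finite D \<and> (\<forall>(c, d)\<in>D. c \<in> {a..b} \<and> d \<in> {a..b} \<and> c \<le> d) \<and>
        disjoint_family_on (\<lambda>(a, b). {a<..<b}) D \<and> (\<Sum>(a, b)\<in>D. b - a) < \<delta>
        \<longrightarrow> (\<Sum>(a, b)\<in>D. dist (f (a + h)) (f (b + h))) < e"
  proof (intro exI conjI allI impI, rule d(1))
    fix D assume D: "finite D \<and> (\<forall>(c, d)\<in>D. c \<in> {a..b} \<and> d \<in> {a..b} \<and> c \<le> d) \<and>
        disjoint_family_on (\<lambda>(a, b). {a<..<b}) D \<and> (\<Sum>(a, b)\<in>D. b - a) < \<delta>"
    have *: "(\<Sum>(a, b)\<in>?s ` D. g a b) = (\<Sum>(a, b)\<in>D. g (a + h) (b + h))" for g :: "real \<Rightarrow> real \<Rightarrow> real"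
      by (subst sum.reindex[OF inj]) (simp add: case_prod_unfold o_def)
    have disj: "disjoint_family_on (\<lambda>(a, b). {a<..<b}) (?s ` D)"
      unfolding disjoint_family_on_def
    proof (intro ballI impI)
      fix p q assume "p \<in> ?s ` D" "q \<in> ?s ` D" and ne: "p \<noteq> q"
      then obtain a b c d where H: "(a, b) \<in> D" "(c, d) \<in> D" and pq: "p = (a + h, b + h)" "q = (c + h, d + h)"
        by auto
      then have "{a<..<b} \<inter> {c<..<d} = {}"
        using D ne pq disjoint_family_onD[of "\<lambda>(a, b). {a<..<b}" D "(a, b)" "(c, d)"] by auto
      then show "(case p of (a, b) \<Rightarrow> {a<..<b}) \<inter> (case q of (a, b) \<Rightarrow> {a<..<b}) = {}"
        by (simp add: pq min_def max_def split: if_splits)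
    qed
    have "(\<Sum>(a, b)\<in>?s ` D. dist (f a) (f b)) < e"
      using D disj by (intro d(2)) (auto simp: *)
    then show "(\<Sum>(a, b)\<in>D. dist (f (a + h)) (f (b + h))) < e" by (simp add: *)
  qed
qed

section \<open>Sums, products and smooth functions\<close>

lemma abs_continuous_on_add:
  fixes f g :: "real \<Rightarrow> 'a::real_normed_vector"
  assumes "abs_continuous_on S f" "abs_continuous_on S g"
  shows "abs_continuous_on S (\<lambda>t. f t + g t)"
  using assms
  by (rule abs_continuous_on_dominated2[where K = 1]) (simp add: dist_triangle_add)

lemma abs_continuous_on_diff:
  fixes f g :: "real \<Rightarrow> 'a::real_normed_vector"
  assumes "abs_continuous_on S f" "abs_continuous_on S g"
  shows "abs_continuous_on S (\<lambda>t. f t - g t)"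
  using assms
proof (rule abs_continuous_on_dominated2[where K = 1])
  fix s t
  show "dist (f s - g s) (f t - g t) \<le> 1 * (dist (f s) (f t) + dist (g s) (g t))"
    using norm_triangle_ineq4[of "f s - f t" "g s - g t"] by (simp add: dist_norm algebra_simps)
qed

lemma abs_continuous_on_const: "abs_continuous_on S (\<lambda>_. c)"
  by (rule abs_continuous_on_lipschitz[where L = 0]) simp

lemma abs_continuous_on_id: "abs_continuous_on S (\<lambda>t::real. t)"
  by (rule abs_continuous_on_lipschitz[where L = 1]) (simp add: dist_real_def)

text \<open>On a compact interval both factors are bounded, and the increment of a product splits
  into two terms, each containing the increment of one factor. It is used for real products, scaling
  and inner products.\<close>

lemma (in bounded_bilinear) abs_continuous_on:
  assumes f: "abs_continuous_on {a..b} f" and g: "abs_continuous_on {a..b} g"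
  shows "abs_continuous_on {a..b} (\<lambda>t. prod (f t) (g t))"
proof -
  obtain K where K: "K > 0" "\<And>a b. norm (prod a b) \<le> norm a * norm b * K"
    using pos_bounded by blast
  have "bounded (f ` {a..b})" "bounded (g ` {a..b})"
    using f g by (auto intro!: compact_imp_bounded compact_continuous_image abs_continuous_on_imp_continuous_on)
  then obtain A B where A: "\<And>t. t \<in> {a..b} \<Longrightarrow> norm (f t) \<le> A" and B: "\<And>t. t \<in> {a..b} \<Longrightarrow> norm (g t) \<le> B"
    by (fastforce simp: bounded_iff)
  show ?thesis
  proof (rule abs_continuous_on_dominated2[OF f g, where K = "max A B * K"])
    fix s t assume st: "s \<in> {a..b}" "t \<in> {a..b}"
    have "prod (f s) (g s) - prod (f t) (g t) = prod (f s - f t) (g s) + prod (f t) (g s - g t)"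
      by (simp add: diff_left diff_right)
    also have "norm \<dots> \<le> norm (f s - f t) * norm (g s) * K + norm (f t) * norm (g s - g t) * K"
      using K(2) by (intro norm_triangle_mono) auto
    also have "\<dots> \<le> norm (f s - f t) * max A B * K + max A B * norm (g s - g t) * K"
      using st K(1) A[of t] B[of s]
      by (intro add_mono mult_right_mono mult_left_mono) auto
    finally show "dist (prod (f s) (g s)) (prod (f t) (g t)) \<le> max A B * K * (dist (f s) (f t) + dist (g s) (g t))"
      by (simp add: dist_norm algebra_simps)
  qed
qed

lemma abs_continuous_on_C1:
  fixes f :: "real \<Rightarrow> 'a::real_normed_vector"
  assumes deriv: "\<And>t. t \<in> {a..b} \<Longrightarrow> (f has_vector_derivative f' t) (at t within {a..b})"
    and cont: "continuous_on {a..b} f'"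
  shows "abs_continuous_on {a..b} f"
proof -
  have "bounded (f' ` {a..b})" using cont by (intro compact_imp_bounded compact_continuous_image) auto
  then obtain M where M: "\<forall>t\<in>{a..b}. norm (f' t) \<le> M" unfolding bounded_iff by blast
  show ?thesis
  proof (rule abs_continuous_on_lipschitz[where L = M])
    fix s t assume st: "s \<in> {a..b}" "t \<in> {a..b}" "s \<le> t"
    have "norm (f t - f s) \<le> M * norm (t - s)"
    proof (rule differentiable_bound[of "{a..b}"])
      show "(f has_derivative (\<lambda>h. h *\<^sub>R f' r)) (at r within {a..b})" if "r \<in> {a..b}" for r
        using deriv[OF that] by (simp add: has_vector_derivative_def)
      show "onorm (\<lambda>h. h *\<^sub>R f' r) \<le> M" if "r \<in> {a..b}" for r
        using M that by (simp add: onorm_scaleR_left onorm_id bounded_linear_ident)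
    qed (use st in auto)
    then show "dist (f s) (f t) \<le> M * (t - s)" using st by (simp add: dist_norm norm_minus_commute)
  qed
qed

section \<open>Monotonicity and Lipschitz bounds from pointwise derivatives off a null set\<close>

text \<open>Going left from \<open>b\<close>, the increase of \<open>f\<close> is controlled by the minorants outside an open
  superset \<open>U\<close> of \<open>N\<close> of small measure, and by the variation \<open>h\<close> of \<open>f\<close> on \<open>U\<close> elsewhere.\<close>

lemma abs_continuous_on_antimono:
  fixes f :: "real \<Rightarrow> real"
  assumes f: "abs_continuous_on {a..b} f" and "a \<le> b" and N: "negligible N"
    and minorant: "\<And>t. t \<in> {a..b} - N \<Longrightarrow> \<exists>F d. (F has_real_derivative d) (at t) \<and> d \<le> 0 \<and>
      F t = f t \<and> (\<forall>s\<in>{a..b}. F s \<le> f s)"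
  shows "f b \<le> f a"
proof -
  have main: "f b - f a \<le> \<epsilon> * (b - a) + \<epsilon>" if e: "\<epsilon> > 0" for \<epsilon>
  proof -
    obtain \<delta> where d: "\<delta> > 0" "\<And>D. finite D \<Longrightarrow> (\<forall>(c, d)\<in>D. c \<in> {a..b} \<and> d \<in> {a..b} \<and> c \<le> d) \<Longrightarrow>
        disjoint_family_on (\<lambda>(a, b). {a<..<b}) D \<Longrightarrow> (\<Sum>(a, b)\<in>D. b - a) < \<delta>
        \<Longrightarrow> (\<Sum>(a, b)\<in>D. dist (f a) (f b)) < \<epsilon>"
      by (rule abs_continuous_onE[OF f e]) blast
    have N0: "N \<in> null_sets lebesgue" using N by (simp add: negligible_iff_null_sets)
    obtain U where U: "open U" "N \<subseteq> U" "U - N \<in> lmeasurable" "emeasure lebesgue (U - N) < ennreal \<delta>"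
      using sets_lebesgue_outer_open[of N \<delta>] N0 d(1) by blast
    have Ul: "U \<in> lmeasurable"
      using fmeasurable.Un[OF U(3) negligible_imp_measurable[OF N]] U(2) by (simp add: Un_absorb2)
    have "emeasure lebesgue U < ennreal \<delta>"
      using U(4) N0 emeasure_Diff_null_set[of N lebesgue U] Ul by (simp add: fmeasurableD)
    then have Um: "measure lebesgue U < \<delta>"
      using Ul d(1) by (simp add: emeasure_eq_measure2 ennreal_less_iff)
    \<comment> \<open>\<open>h s\<close>, the supremum of \<open>\<sigma>\<close> over
      \<open>P s\<close>, is the variation of \<open>f\<close> over the part of \<open>U\<close>
      inside \<open>{s..b}\<close>. Since \<open>U\<close> has measure below
      \<open>\<delta>\<close>, absolute continuity keeps it at most
      \<open>\<epsilon>\<close>.\<close>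
    define P where "P s = {D. finite D \<and> (\<forall>(c, d)\<in>D. s \<le> c \<and> c \<le> d \<and> d \<le> b \<and> {c..d} \<subseteq> U) \<and>
        disjoint_family_on (\<lambda>(a, b). {a<..<b}) D}" for s
    define \<sigma> where "\<sigma> D = (\<Sum>(c, d)\<in>D. dist (f c) (f d))" for D
    define h where "h s = Sup (\<sigma> ` P s)" for s
    have sig: "\<sigma> D < \<epsilon>" if D: "D \<in> P s" "s \<ge> a" for D s
      unfolding \<sigma>_def
    proof (rule d(2))
      have "(\<Sum>(c, d)\<in>D. d - c) = (\<Sum>p\<in>D. measure lebesgue (case p of (c, d) \<Rightarrow> {c<..<d}))"
        using D by (intro sum.cong) (auto simp: P_def)
      also have "\<dots> = measure lebesgue (\<Union>p\<in>D. case p of (c, d) \<Rightarrow> {c<..<d})"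
        using D by (intro measure_finite_Union[symmetric]) (auto simp: P_def)
      also have "\<dots> \<le> measure lebesgue U"
      proof (rule measure_mono_fmeasurable[OF _ _ Ul])
        show "(\<Union>p\<in>D. case p of (c, d) \<Rightarrow> {c<..<d}) \<subseteq> U"
        proof (rule UN_least, clarify)
          fix c d r assume "(c, d) \<in> D" "r \<in> {c<..<d}"
          then have "r \<in> {c..d}" "{c..d} \<subseteq> U" using D by (auto simp: P_def)
          then show "r \<in> U" by blast
        qed
        show "(\<Union>p\<in>D. case p of (c, d) \<Rightarrow> {c<..<d}) \<in> sets lebesgue"
          using D by (intro sets.finite_UN) (auto simp: P_def)
      qed
      finally show "(\<Sum>(c, d)\<in>D. d - c) < \<delta>" using Um by simp
    qed (use D in \<open>auto simp: P_def\<close>)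
    have bdd: "bdd_above (\<sigma> ` P s)" if "s \<ge> a" for s
      using sig[OF _ that] by (auto simp: bdd_above_def intro!: exI[of _ \<epsilon>] less_imp_le)
    have emp: "{} \<in> P s" for s by (simp add: P_def disjoint_family_on_def)
    have h_le: "h s \<le> \<epsilon>" if "s \<ge> a" for s
      unfolding h_def using emp sig[OF _ that] by (intro cSUP_least) (auto intro: less_imp_le)
    have h_ge0: "0 \<le> h s" if "s \<ge> a" for s
      unfolding h_def using cSUP_upper[OF emp bdd[OF that]] by (simp add: \<sigma>_def)
    have h_anti: "h s' \<le> h s" if "a \<le> s" "s \<le> s'" for s s'
    proof -
      have "P s' \<subseteq> P s" using that(2) by (force simp: P_def)
      then show ?thesis unfolding h_def using emp that by (intro cSUP_subset_mono bdd) auto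
    qed
    have h_step: "h s + \<bar>f s - f r\<bar> \<le> h r" if "a \<le> r" "r < s" "s \<le> b" "{r..s} \<subseteq> U" for r s
    proof -
      have "h s \<le> h r - \<bar>f s - f r\<bar>"
        unfolding h_def[of s]
      proof (rule cSUP_least)
        fix D assume D: "D \<in> P s"
        have nin: "(r, s) \<notin> D" using D that by (auto simp: P_def)
        \<comment> \<open>The intervals of \<open>D\<close> lie to the right of \<open>s\<close>, so
          the new one does not overlap them.\<close>
        have "insert (r, s) D \<in> P r"
        proof -
          have "{r<..<s} \<inter> (case p of (c, d) \<Rightarrow> {c<..<d}) = {}" if "p \<in> D" for p
            using D that by (auto simp: P_def)
          then show ?thesis
            using D that nin by (auto simp: P_def disjoint_family_on_insert)
        qed
        then have "\<sigma> (insert (r, s) D) \<le> h r"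
          unfolding h_def by (intro cSUP_upper bdd) (use that in auto)
        moreover have "\<sigma> (insert (r, s) D) = dist (f r) (f s) + \<sigma> D"
          using D nin by (simp add: \<sigma>_def P_def)
        ultimately show "\<sigma> D \<le> h r - \<bar>f s - f r\<bar>" by (simp add: dist_real_def)
      qed (use emp in auto)
      then show ?thesis by simp
    qed
    \<comment> \<open>Induction from \<open>b\<close> to the left: \<open>S\<close> collects the
      points where the estimate holds, and its infimum turns out to be \<open>a\<close>.\<close>
    define S where "S = {s\<in>{a..b}. f b - f s \<le> \<epsilon> * (b - s) + h s}"
    have bS: "b \<in> S" using h_ge0[of b] \<open>a \<le> b\<close> by (simp add: S_def)
    have Sbdd: "bdd_below S" by (auto simp: S_def bdd_below_def)
    define t where "t = Inf S"
    have tS: "t \<le> s" if "s \<in> S" for s unfolding t_def using that Sbdd by (rule cInf_lower)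
    have at: "a \<le> t" unfolding t_def using bS by (intro cInf_greatest) (auto simp: S_def)
    \<comment> \<open>\<open>h\<close> need not be continuous. Replacing \<open>h s\<close> by the
      larger constant \<open>h t\<close> gives a closed condition that holds on \<open>S\<close>; at
      \<open>t\<close> itself it is again the condition defining \<open>S\<close>.\<close>
    have "t \<in> {s\<in>{a..b}. f b - f s - \<epsilon> * (b - s) \<le> h t}" (is "_ \<in> ?C")
    proof -
      have "closed ?C"
        by (intro continuous_on_closed_Collect_le continuous_intros
             abs_continuous_on_imp_continuous_on[OF f])
      moreover have "S \<subseteq> ?C"
      proof
        fix s assume s: "s \<in> S"
        then show "s \<in> ?C" using h_anti[OF at tS[OF s]] by (auto simp: S_def)
      qed
      ultimately have "closure S \<subseteq> ?C" by (simp add: closure_minimal)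
      then show ?thesis using closure_contains_Inf[OF _ Sbdd] bS unfolding t_def by blast
    qed
    then have t: "t \<in> S" "t \<in> {a..b}" by (auto simp: S_def)
    have "t = a"
    proof (rule ccontr)
      assume "t \<noteq> a"
      then have "a < t" using at by simp
      \<comment> \<open>The estimate extends strictly to the left of \<open>t\<close>: at a point of
        \<open>N\<close> the change of \<open>f\<close> is paid for by \<open>h\<close>, elsewhere
        by the slope of the minorant.\<close>
      have "\<exists>r. a \<le> r \<and> r < t \<and> f t - f r + h t \<le> \<epsilon> * (t - r) + h r"
      proof (cases "t \<in> N")
        case True
        then obtain e where e: "e > 0" "ball t e \<subseteq> U" using U(1,2) openE by blast
        define r where "r = max a (t - e / 2)"
        have r: "a \<le> r" "r < t" "t - r \<le> e / 2" using \<open>a < t\<close> e(1) by (auto simp: r_def max_def)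
        have "{r..t} \<subseteq> U" using e r by (auto simp: subset_iff dist_real_def)
        from h_step[OF r(1,2) _ this] t(2) have "h t + \<bar>f t - f r\<bar> \<le> h r" by auto
        moreover have "\<epsilon> * (t - r) \<ge> 0" using \<open>\<epsilon> > 0\<close> r by simp
        ultimately show ?thesis using r by (intro exI[of _ r]) auto
      next
        case False
        obtain F d where F: "(F has_real_derivative d) (at t)" "d \<le> 0" "F t = f t" "\<And>s. s \<in> {a..b} \<Longrightarrow> F s \<le> f s"
          using minorant[of t] t(2) False by blast
        have "((\<lambda>s. (F s - F t) / (s - t)) \<longlongrightarrow> d) (at t)"
          using F(1) by (simp add: has_field_derivative_iff)
        then have "\<forall>\<^sub>F s in at t. (F s - F t) / (s - t) < \<epsilon>"
            by (rule order_tendstoD(2)) (use F(2) \<open>\<epsilon> > 0\<close> in simp)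
        then have "\<forall>\<^sub>F s in at_left t. (F s - F t) / (s - t) < \<epsilon>"
          by (simp add: eventually_at_split)
        moreover have "\<forall>\<^sub>F s in at_left t. a < s" "\<forall>\<^sub>F s in at_left t. s < t"
          using \<open>a < t\<close> by (auto simp: eventually_at_left intro: exI[of _ a])
        ultimately have "\<forall>\<^sub>F s in at_left t. (F s - F t) / (s - t) < \<epsilon> \<and> a < s \<and> s < t"
          by (intro eventually_conj) auto
        then obtain r where r: "(F r - F t) / (r - t) < \<epsilon>" "a < r" "r < t"
          using eventually_happens' trivial_limit_at_left_real by blast
        \<comment> \<open>\<open>F\<close> touches \<open>f\<close> at \<open>t\<close> and lies
          below it at \<open>r\<close>; since \<open>r\<close> is to the left of \<open>t\<close>,
          this is the direction that is wanted.\<close>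
        have "f t - f r \<le> F t - F r" using F(3) F(4)[of r] r t(2) by auto
        also have "\<dots> \<le> \<epsilon> * (t - r)"
          using r by (simp add: divide_simps algebra_simps)
        finally show ?thesis using h_anti[of r t] r by (intro exI[of _ r]) auto
      qed
      then obtain r where r: "a \<le> r" "r < t" "f t - f r + h t \<le> \<epsilon> * (t - r) + h r" by blast
      have "f b - f r \<le> \<epsilon> * (b - r) + h r" using r(3) t(1) by (auto simp: S_def algebra_simps)
      then have "r \<in> S" using r t(2) by (auto simp: S_def)
      with tS r show False by force
    qed
    with t(1) have "f b - f a \<le> \<epsilon> * (b - a) + h a" by (simp add: S_def)
    with h_le[of a] show ?thesis by simp
  qed
  show ?thesis
  proof (rule field_le_epsilon)
    fix e :: real assume "e > 0"
    then have "e / (b - a + 1) > 0" using \<open>a \<le> b\<close> by simp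
    from main[OF this] have "f b - f a \<le> e / (b - a + 1) * (b - a + 1)" by (simp only: distrib_left mult_1_right)
    also have "\<dots> = e" using \<open>a \<le> b\<close> by simp
    finally show "f b \<le> f a + e" by simp
  qed
qed

text \<open>A vector version of the mean value inequality without vector integration: test
  \<open>f\<close> against its own total increment \<open>e\<close> and apply the scalar
  monotonicity result to \<open>e \<bullet> f t - norm e * M * t\<close>.\<close>

lemma abs_continuous_on_lipschitz_bound:
  fixes f :: "real \<Rightarrow> 'a::real_inner"
  assumes f: "abs_continuous_on {a..b} f" and "a \<le> b" and "0 \<le> M" and N: "negligible N"
    and deriv: "\<And>t. t \<in> {a..b} - N \<Longrightarrow> \<exists>d. (f has_vector_derivative d) (at t) \<and> norm d \<le> M"
  shows "norm (f b - f a) \<le> M * (b - a)"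
proof -
  define e where "e = f b - f a"
  define g where "g t = e \<bullet> f t - norm e * M * t" for t
  have "g b \<le> g a"
  proof (rule abs_continuous_on_antimono[OF _ \<open>a \<le> b\<close> N])
    show "abs_continuous_on {a..b} g"
    proof (rule abs_continuous_on_dominated2[OF f abs_continuous_on_id, where K = "norm e * (1 + \<bar>M\<bar>)"])
      fix s t
      have "\<bar>g s - g t\<bar> = \<bar>e \<bullet> (f s - f t) - norm e * M * (s - t)\<bar>"
        by (simp add: g_def algebra_simps)
      also have "\<dots> \<le> \<bar>e \<bullet> (f s - f t)\<bar> + \<bar>norm e * M * (s - t)\<bar>" by simp
      also have "\<dots> \<le> norm e * norm (f s - f t) + norm e * \<bar>M\<bar> * \<bar>s - t\<bar>"
        by (intro add_mono Cauchy_Schwarz_ineq2) (simp add: abs_mult)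
      also have "\<dots> \<le> norm e * (1 + \<bar>M\<bar>) * (norm (f s - f t) + \<bar>s - t\<bar>)"
        by (simp add: algebra_simps)
      finally show "dist (g s) (g t) \<le> norm e * (1 + \<bar>M\<bar>) * (dist (f s) (f t) + dist s t)"
        by (simp add: dist_norm)
    qed
    fix t assume "t \<in> {a..b} - N"
    from deriv[OF this] obtain d where d: "(f has_vector_derivative d) (at t)" "norm d \<le> M" by blast
    have "(g has_real_derivative e \<bullet> d - norm e * M) (at t)"
      using d(1) unfolding g_def has_real_derivative_iff_has_vector_derivative has_vector_derivative_def
      by (auto intro!: derivative_eq_intros simp: algebra_simps)
    moreover have "e \<bullet> d \<le> norm e * M"
      by (meson d(2) mult_left_mono norm_cauchy_schwarz norm_ge_zero order_trans)
    ultimately show "\<exists>F d. (F has_real_derivative d) (at t) \<and> d \<le> 0 \<and> F t = g t \<and> (\<forall>s\<in>{a..b}. F s \<le> g s)"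
      by (intro exI[of _ g] exI[of _ "e \<bullet> d - norm e * M"]) auto
  qed
  then have "norm e * norm e \<le> norm e * (M * (b - a))"
    unfolding g_def power2_eq_square[symmetric] power2_norm_eq_inner e_def[symmetric]
    by (simp add: e_def inner_diff_right algebra_simps)
  then have "norm e \<le> M * (b - a)"
    using \<open>0 \<le> M\<close> \<open>a \<le> b\<close> by (cases "e = 0") simp_all
  then show ?thesis by (simp add: e_def)
qed

text \<open>Lets bounds on small forward increments pass to the derivative. The reverse triangle
  inequality reduces it to the definition of the derivative.\<close>

lemma has_vector_derivative_norm_quotient:
  assumes "(f has_vector_derivative v) (at t)"
  shows "((\<lambda>h. norm (f (t + h) - f t) / h) \<longlongrightarrow> norm v) (at_right 0)"
proof (rule LIM_zero_cancel, rule Lim_null_comparison)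
  have "((\<lambda>h. norm (f (t + h) - f t - h *\<^sub>R v) / norm h) \<longlongrightarrow> 0) (at 0)"
    using assms unfolding has_vector_derivative_def has_derivative_at by blast
  then show "((\<lambda>h. norm (f (t + h) - f t - h *\<^sub>R v) / norm h) \<longlongrightarrow> 0) (at_right 0)"
    by (rule filterlim_mono[OF _ order_refl]) (simp add: at_le)
  have "norm (norm (f (t + h) - f t) / h - norm v) \<le> norm (f (t + h) - f t - h *\<^sub>R v) / norm h"
    if "h > 0" for h
  proof -
    have "norm (f (t + h) - f t) / h - norm v = (norm (f (t + h) - f t) - norm (h *\<^sub>R v)) / h"
      using that by (simp add: field_simps)
    then show ?thesis
      using that norm_triangle_ineq3[of "f (t + h) - f t" "h *\<^sub>R v"] by (simp add: divide_right_mono)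
  qed
  with eventually_at_right_less[of 0] show "\<forall>\<^sub>F h in at_right 0. norm (norm (f (t + h) - f t) / h - norm v)
      \<le> norm (f (t + h) - f t - h *\<^sub>R v) / norm h"
    by (rule eventually_mono)
qed

section \<open>Weak convergence\<close>

text \<open>The elements of almost minimal norm form a Cauchy sequence by the parallelogram law.\<close>

lemma decreasing_convex_sets_Inter_nonempty:
  fixes C :: "nat \<Rightarrow> 'a::{real_inner, complete_space} set"
  assumes conv: "\<And>n. convex (C n)" and cl: "\<And>n. closed (C n)" and ne: "\<And>n. C n \<noteq> {}"
    and bd: "bounded (C 0)" and dec: "\<And>m n. m \<le> n \<Longrightarrow> C n \<subseteq> C m"
  shows "(\<Inter>n. C n) \<noteq> {}"
proof -
  define r where "r n = inverse (real (Suc n))" for n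
  \<comment> \<open>The squared distance from the origin to \<open>C n\<close>. It is nondecreasing
    and bounded, hence convergent; \<open>r n\<close> is the tolerance with which \<open>p n\<close>
    attains it.\<close>
  define e where "e n = Inf ((\<lambda>p. (norm p)\<^sup>2) ` C n)" for n
  have bb: "bdd_below ((\<lambda>p. (norm p)\<^sup>2) ` C n)" for n by (auto simp: bdd_below_def intro: exI[of _ 0])
  have e_le: "e n \<le> (norm p)\<^sup>2" if "p \<in> C n" for n p
    unfolding e_def using that bb by (intro cINF_lower)
  have inc: "e m \<le> e n" if "m \<le> n" for m n
    unfolding e_def using ne bb dec[OF that] by (intro cINF_superset_mono) auto
  obtain R where R: "\<And>p. p \<in> C 0 \<Longrightarrow> norm p \<le> R" using bd by (auto simp: bounded_iff)
  have "e n \<le> R\<^sup>2" for n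
  proof -
    obtain p where p: "p \<in> C n" using ne by blast
    then have "norm p \<le> R" using R dec[of 0 n] by blast
    then have "(norm p)\<^sup>2 \<le> R\<^sup>2" by (intro power_mono) auto
    with e_le[OF p] show ?thesis by linarith
  qed
  then have "\<exists>L. e \<longlonglongrightarrow> L"
    using inc by (metis incseq_convergent incseq_def)
  then have "Cauchy e" using LIMSEQ_imp_Cauchy by blast
  have "\<exists>p\<in>C n. (norm p)\<^sup>2 < e n + r n" for n
    using cINF_less_iff[OF ne bb, of n "e n + r n"] by (simp add: e_def r_def)
  then obtain p where p: "\<And>n. p n \<in> C n" "\<And>n. (norm (p n))\<^sup>2 < e n + r n"
    by metis
  have est: "(norm (p m - p n))\<^sup>2 \<le> 4 * r m + 2 * (e n - e m)" if "m \<le> n" for m n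
  proof -
    \<comment> \<open>\<open>p m\<close> and \<open>p n\<close> both lie in the larger set
      \<open>C m\<close>, hence so does their midpoint, whose squared norm is at least
      \<open>e m\<close>.\<close>
    have "p n \<in> C m" using p(1)[of n] dec[OF that] by blast
    then have "(1/2) *\<^sub>R p m + (1/2) *\<^sub>R p n \<in> C m"
      using conv[of m] p(1)[of m] unfolding convex_def by (auto simp del: scaleR_half_double)
    from e_le[OF this] have mid: "4 * e m \<le> (norm (p m + p n))\<^sup>2"
      by (simp add: power2_norm_eq_inner inner_add algebra_simps)
    have "(norm (p m - p n))\<^sup>2 = 2 * (norm (p m))\<^sup>2 + 2 * (norm (p n))\<^sup>2 - (norm (p m + p n))\<^sup>2"
      by (simp add: power2_norm_eq_inner inner_add inner_diff inner_commute)
    moreover have "r n \<le> r m"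
      using that by (simp add: r_def field_simps)
    ultimately show ?thesis using p(2)[of m] p(2)[of n] mid by argo
  qed
  have "Cauchy p"
  proof (rule metric_CauchyI)
    fix \<epsilon> :: real assume "\<epsilon> > 0"
    then have e2: "\<epsilon>\<^sup>2 / 8 > 0" by simp
    obtain M where M: "\<And>m n. m \<ge> M \<Longrightarrow> n \<ge> M \<Longrightarrow> dist (e m) (e n) < \<epsilon>\<^sup>2 / 8"
      using \<open>Cauchy e\<close> e2 unfolding Cauchy_def by blast
    obtain K where K: "r K < \<epsilon>\<^sup>2 / 8"
      using reals_Archimedean[OF e2] unfolding r_def by blast
    have *: "dist (p m) (p n) < \<epsilon>" if mn: "max M K \<le> m" "m \<le> n" for m n
    proof -
      have "r m \<le> r K" using mn by (simp add: r_def field_simps)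
      moreover have "e n - e m < \<epsilon>\<^sup>2 / 8"
        by (rule le_less_trans[OF _ M[of m n]]) (use mn in \<open>auto simp: dist_real_def\<close>)
      ultimately have "(norm (p m - p n))\<^sup>2 < \<epsilon>\<^sup>2"
        using est[OF mn(2)] K e2 by argo
      then show ?thesis using \<open>\<epsilon> > 0\<close> by (simp add: dist_norm power_less_imp_less_base)
    qed
    show "\<exists>M. \<forall>m\<ge>M. \<forall>n\<ge>M. dist (p m) (p n) < \<epsilon>"
    proof (intro exI allI impI)
      fix m n assume "max M K \<le> m" "max M K \<le> n"
      then show "dist (p m) (p n) < \<epsilon>"
        using *[of m n] *[of n m] by (cases "m \<le> n") (auto simp: dist_commute)
    qed
  qed
  then obtain q where q: "p \<longlonglongrightarrow> q" using Cauchy_convergent_iff convergent_def by blast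
  have "q \<in> C n" for n
  proof (rule Lim_in_closed_set[OF cl _ _ q])
    have "p k \<in> C n" if "k \<ge> n" for k using p(1)[of k] dec[OF that] by blast
    then show "\<forall>\<^sub>F k in sequentially. p k \<in> C n" by (auto simp: eventually_sequentially)
  qed simp
  then show ?thesis by blast
qed

lemma inner_ge_on_closure_convex_hull:
  fixes v :: "'a::real_inner"
  assumes "w \<in> closure (convex hull A)" and "\<And>p. p \<in> A \<Longrightarrow> c \<le> v \<bullet> p"
  shows "c \<le> v \<bullet> w"
proof -
  have "closure (convex hull A) \<subseteq> {p. v \<bullet> p \<ge> c}"
    using assms(2)
    by (intro closure_minimal hull_minimal closed_halfspace_ge convex_halfspace_ge) auto
  then show ?thesis using assms(1) by blast
qed

text \<open>A variant of Opial's lemma in which the weak cluster points of \<open>f\<close> are replaced by the points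
  in the closed convex hulls of all its tails, so that weak compactness is not needed.\<close>

lemma opial:
  fixes f :: "real \<Rightarrow> 'a::{real_inner, complete_space}"
  assumes "S \<noteq> {}"
    and conv: "\<And>z. z \<in> S \<Longrightarrow> \<exists>l. ((\<lambda>t. (norm (f t - z))\<^sup>2) \<longlongrightarrow> l) at_top"
    and tails: "\<And>w. (\<And>T. w \<in> closure (convex hull (f ` {T..}))) \<Longrightarrow> w \<in> S"
  shows "\<exists>z\<in>S. weakly_tendsto f z at_top"
proof -
  define H where "H A = closure (convex hull (f ` A))" for A
  obtain z0 where "z0 \<in> S" using assms(1) by blast
  from conv[OF this] obtain l0 where "((\<lambda>t. (norm (f t - z0))\<^sup>2) \<longlongrightarrow> l0) at_top" by blast
  then have "\<forall>\<^sub>F t in at_top. (norm (f t - z0))\<^sup>2 < l0 + 1" by (rule order_tendstoD) simp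
  then obtain T0 where T0: "\<And>t. t \<ge> T0 \<Longrightarrow> (norm (f t - z0))\<^sup>2 < l0 + 1"
    by (auto simp: eventually_at_top_linorder)
  have bd: "bounded (f ` {T0..})"
  proof (rule bounded_subset[OF bounded_cball])
    show "f ` {T0..} \<subseteq> cball z0 (sqrt (l0 + 1))"
    proof clarsimp
      fix t assume "T0 \<le> t"
      from T0[OF this] show "dist z0 (f t) \<le> sqrt (l0 + 1)"
        by (simp add: dist_norm norm_minus_commute real_le_rsqrt)
    qed
  qed
  \<comment> \<open>A substitute for extracting a weakly convergent subsequence: a property that
    recurs at arbitrarily late times has a common point in the hulls of the values of
    \<open>f\<close> at late times with this property. Starting at \<open>T0\<close> keeps these
    hulls bounded.\<close>
  have key: "\<exists>w. w \<in> H {t. t \<ge> T0 \<and> P t} \<and> (\<forall>T. w \<in> H {t. t \<ge> T \<and> P t})"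
    if P: "\<exists>\<^sub>F t in at_top. P t" for P
  proof -
    let ?C = "\<lambda>n. H {t. t \<ge> T0 + real n \<and> P t}"
    have mono: "H A \<subseteq> H B" if "A \<subseteq> B" for A B
      unfolding H_def using that by (intro closure_mono hull_mono image_mono)
    have "(\<Inter>n. ?C n) \<noteq> {}"
    proof (rule decreasing_convex_sets_Inter_nonempty)
      fix n
      have "\<not> (\<forall>t\<ge>T0 + real n. \<not> P t)"
        using P unfolding frequently_def eventually_at_top_linorder by blast
      then show "?C n \<noteq> {}" by (auto simp: H_def)
      have "bounded (f ` {t. t \<ge> T0 + real 0 \<and> P t})" by (rule bounded_subset[OF bd]) auto
      then show "bounded (?C 0)" unfolding H_def by (intro bounded_closure bounded_convex_hull)
    next
      fix m n :: nat assume "m \<le> n"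
      then show "?C n \<subseteq> ?C m" by (intro mono) auto
    qed (auto simp: H_def)
    then obtain w where w: "\<And>n. w \<in> ?C n" by blast
    have "w \<in> H {t. t \<ge> T \<and> P t}" for T
    proof -
      obtain n where "T - T0 \<le> real n" using real_arch_simple by blast
      then have "?C n \<subseteq> H {t. t \<ge> T \<and> P t}" by (intro mono) auto
      then show ?thesis using w by blast
    qed
    then show ?thesis by blast
  qed
  have inS: "w \<in> S" if "\<And>T. w \<in> H {T..}" for w
    by (rule tails) (use that in \<open>simp add: H_def\<close>)
  \<comment> \<open>A closed half-space slightly larger than the one bounded by the limit contains a
    whole tail, hence also its closed convex hull.\<close>
  have lim_inner: "v \<bullet> w = l" if w: "\<And>T. w \<in> H {T..}" and l: "((\<lambda>t. v \<bullet> f t) \<longlongrightarrow> l) at_top" for v w l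
  proof (rule antisym)
    show "v \<bullet> w \<le> l"
    proof (rule field_le_epsilon)
      fix e :: real assume "e > 0"
      then have "\<forall>\<^sub>F t in at_top. v \<bullet> f t < l + e" using order_tendstoD(2)[OF l, of "l + e"] by simp
      then obtain T where "\<And>t. t \<ge> T \<Longrightarrow> v \<bullet> f t < l + e" by (auto simp: eventually_at_top_linorder)
      then have "\<forall>t\<ge>T. - (l + e) \<le> (- v) \<bullet> f t" by fastforce
      then have "- (l + e) \<le> (- v) \<bullet> w"
        by (intro inner_ge_on_closure_convex_hull[OF w[of T, unfolded H_def]]) auto
      then show "v \<bullet> w \<le> l + e" by simp
    qed
    show "l \<le> v \<bullet> w"
    proof (rule field_le_epsilon)
      fix e :: real assume "e > 0"
      then have "\<forall>\<^sub>F t in at_top. v \<bullet> f t > l - e" using order_tendstoD(1)[OF l, of "l - e"] by simp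
      then obtain T where "\<And>t. t \<ge> T \<Longrightarrow> v \<bullet> f t > l - e" by (auto simp: eventually_at_top_linorder)
      then have "\<forall>t\<ge>T. l - e \<le> v \<bullet> f t" by (auto intro: less_imp_le)
      then have "l - e \<le> v \<bullet> w"
        by (intro inner_ge_on_closure_convex_hull[OF w[of T, unfolded H_def]]) auto
      then show "l \<le> v \<bullet> w + e" by simp
    qed
  qed
  \<comment> \<open>Both points lie in \<open>S\<close>, so both distances converge; their
    difference shows that \<open>(w1 - w2) \<bullet> f t\<close> converges, and its limit is the
    value at \<open>w1\<close> and at \<open>w2\<close>.\<close>
  have uniq: "w1 = w2" if w: "\<And>T. w1 \<in> H {T..}" "\<And>T. w2 \<in> H {T..}" for w1 w2
  proof -
    from conv[OF inS[OF w(1)]] obtain l1 where l1: "((\<lambda>t. (norm (f t - w1))\<^sup>2) \<longlongrightarrow> l1) at_top" by blast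
    from conv[OF inS[OF w(2)]] obtain l2 where l2: "((\<lambda>t. (norm (f t - w2))\<^sup>2) \<longlongrightarrow> l2) at_top" by blast
    have "((\<lambda>t. ((norm (f t - w2))\<^sup>2 - (norm (f t - w1))\<^sup>2 + (norm w1)\<^sup>2 - (norm w2)\<^sup>2) / 2) \<longlongrightarrow>
        (l2 - l1 + (norm w1)\<^sup>2 - (norm w2)\<^sup>2) / 2) at_top"
      by (intro tendsto_divide tendsto_add tendsto_diff tendsto_const l1 l2) simp
    also have "(\<lambda>t. ((norm (f t - w2))\<^sup>2 - (norm (f t - w1))\<^sup>2 + (norm w1)\<^sup>2 - (norm w2)\<^sup>2) / 2) =
        (\<lambda>t. (w1 - w2) \<bullet> f t)"
      by (simp add: power2_norm_eq_inner inner_diff_left inner_diff_right inner_commute fun_eq_iff)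
    finally have lim: "((\<lambda>t. (w1 - w2) \<bullet> f t) \<longlongrightarrow> (l2 - l1 + (norm w1)\<^sup>2 - (norm w2)\<^sup>2) / 2) at_top" .
    have "(w1 - w2) \<bullet> w1 = (w1 - w2) \<bullet> w2"
      using lim_inner[OF w(1) lim] lim_inner[OF w(2) lim] by simp
    then have "(w1 - w2) \<bullet> (w1 - w2) = 0" by (simp add: inner_diff_right)
    then show ?thesis by simp
  qed
  obtain w where w: "\<And>T. w \<in> H {T..}"
    using key[of "\<lambda>_. True"] by (auto simp: atLeast_def)
  \<comment> \<open>If the inequality recurred, the late times satisfying it would yield a tail
    point in a half-space missing \<open>w\<close>, against uniqueness.\<close>
  have sub: "\<not> (\<exists>\<^sub>F t in at_top. v \<bullet> f t \<ge> v \<bullet> w + e)" if "e > 0" for v e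
  proof
    assume "\<exists>\<^sub>F t in at_top. v \<bullet> f t \<ge> v \<bullet> w + e"
    from key[OF this] obtain w' where w': "\<And>T. w' \<in> H {t. t \<ge> T \<and> v \<bullet> f t \<ge> v \<bullet> w + e}" by blast
    have "H {t. t \<ge> T \<and> v \<bullet> f t \<ge> v \<bullet> w + e} \<subseteq> H {T..}" for T
      unfolding H_def by (intro closure_mono hull_mono image_mono) auto
    then have "w' = w" using w' w by (intro uniq) (rule subsetD)
    moreover have "v \<bullet> w + e \<le> v \<bullet> w'"
      using w'[of 0] unfolding H_def by (rule inner_ge_on_closure_convex_hull) auto
    ultimately show False using \<open>e > 0\<close> by simp
  qed
  have "weakly_tendsto f w at_top"
    unfolding weakly_tendsto_def
  proof (intro allI tendstoI)
    fix v and e :: real assume "e > 0"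
    \<comment> \<open>The one-sided estimate for \<open>v\<close> and for its negative gives both
      bounds.\<close>
    have "\<forall>\<^sub>F t in at_top. \<not> (v \<bullet> f t \<ge> v \<bullet> w + e)" "\<forall>\<^sub>F t in at_top. \<not> ((-v) \<bullet> f t \<ge> (-v) \<bullet> w + e)"
      using sub[OF \<open>e > 0\<close>] unfolding frequently_def not_not by blast+
    then show "\<forall>\<^sub>F t in at_top. dist (f t \<bullet> v) (w \<bullet> v) < e"
      by eventually_elim (auto simp: dist_real_def inner_commute)
  qed
  then show ?thesis using inS[OF w] by blast
qed

section \<open>Limits of real functions at infinity\<close>

lemma antimono_bounded_tendsto_at_top:
  fixes f :: "real \<Rightarrow> real"
  assumes anti: "\<And>s t. a \<le> s \<Longrightarrow> s \<le> t \<Longrightarrow> f t \<le> f s" and lower: "\<And>t. a \<le> t \<Longrightarrow> c \<le> f t"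
  shows "\<exists>l. (f \<longlongrightarrow> l) at_top"
proof (rule exI)
  have bb: "bdd_below (f ` {a..})" using lower by (auto simp: bdd_below_def)
  show "(f \<longlongrightarrow> Inf (f ` {a..})) at_top"
  proof (rule order_tendstoI)
    fix y assume y: "y < Inf (f ` {a..})"
    have "y < f t" if "t \<ge> a" for t
      using cINF_lower[OF bb, of t] that y by simp
    then show "\<forall>\<^sub>F t in at_top. y < f t" by (auto simp: eventually_at_top_linorder)
  next
    fix y assume "Inf (f ` {a..}) < y"
    then obtain s where "s \<ge> a" "f s < y" using cINF_less_iff[OF _ bb] by auto
    then have "f t < y" if "t \<ge> s" for t using anti[of s t] that by simp
    then show "\<forall>\<^sub>F t in at_top. f t < y" by (auto simp: eventually_at_top_linorder)
  qed
qed

lemma filterlim_powr_at_top: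
  fixes c :: real
  assumes "c > 0"
  shows "filterlim (\<lambda>t. t powr c) at_top at_top"
proof -
  have "filterlim (\<lambda>t. exp (c * ln t)) at_top at_top"
    by (intro filterlim_compose[OF exp_at_top] filterlim_tendsto_pos_mult_at_top[OF tendsto_const assms ln_at_top])
  moreover have "\<forall>\<^sub>F t in at_top. exp (c * ln t) = t powr c"
    using eventually_gt_at_top[of 0] by eventually_elim (simp add: powr_def)
  ultimately show ?thesis by (rule filterlim_mono_eventually[OF _ order_refl order_refl])
qed

section \<open>Convex functions\<close>

lemma lsc_closed_sublevel:
  assumes "lsc \<phi>"
  shows "closed {p. \<phi> p \<le> c}"
proof -
  have "open {p. c < \<phi> p}"
  proof (subst open_subopen, rule ballI)
    fix p assume "p \<in> {p. c < \<phi> p}"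
    then have p: "c < \<phi> p" by simp
    also have "\<phi> p \<le> Liminf (at p) \<phi>" using assms by (simp add: lsc_def)
    finally have "\<forall>\<^sub>F q in at p. c < \<phi> q" by (rule less_LiminfD)
    then obtain T where "open T" "p \<in> T" "\<forall>q\<in>T. q \<noteq> p \<longrightarrow> c < \<phi> q"
      by (auto simp: eventually_at_topological)
    \<comment> \<open>The filter \<open>at p\<close> leaves out \<open>p\<close> itself, where the
      inequality is already known.\<close>
    moreover from this p have "T \<subseteq> {p. c < \<phi> p}" by auto
    ultimately show "\<exists>T. open T \<and> p \<in> T \<and> T \<subseteq> {p. c < \<phi> p}" by blast
  qed
  moreover have "- {p. \<phi> p \<le> c} = {p. c < \<phi> p}" by auto
  ultimately show ?thesis unfolding closed_def by (simp only:)
qed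

lemma econvex_convex_sublevel:
  assumes "econvex \<phi>" shows "convex {p. \<phi> p \<le> ereal c}"
  unfolding convex_alt
proof (intro ballI allI impI)
  fix p q and u :: real
  assume pq: "p \<in> {p. \<phi> p \<le> ereal c}" "q \<in> {p. \<phi> p \<le> ereal c}" and u: "0 \<le> u \<and> u \<le> 1"
  show "(1 - u) *\<^sub>R p + u *\<^sub>R q \<in> {p. \<phi> p \<le> ereal c}"
  \<comment> \<open>\<open>econvex\<close> speaks only of weights in the open interval, so the
    endpoints are treated apart.\<close>
  proof (cases "u = 0 \<or> u = 1")
    case True then show ?thesis using pq by auto
  next
    case False
    with u have "u \<in> {0<..<1}" by auto
    with assms have "\<phi> ((1 - u) *\<^sub>R p + u *\<^sub>R q) \<le> ereal (1 - u) * \<phi> p + ereal u * \<phi> q"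
      unfolding econvex_def by blast
    also have "\<dots> \<le> ereal (1 - u) * ereal c + ereal u * ereal c"
      using pq u by (intro add_mono ereal_mult_left_mono) auto
    also have "\<dots> = ereal c" by (simp add: algebra_simps)
    finally show ?thesis by simp
  qed
qed

text \<open>Tested at a point of finite value, the subgradient inequality excludes the value
  \<open>\<infinity>\<close> at \<open>p\<close>.\<close>

lemma subdifferential_finite:
  assumes "proper \<phi>" "\<xi> \<in> subdifferential \<phi> p"
  shows "\<phi> p = ereal (real_of_ereal (\<phi> p))"
proof -
  obtain q where "\<phi> q < \<infinity>" using assms(1) by (auto simp: proper_def edom_def)
  moreover have "\<phi> p + ereal (\<xi> \<bullet> (q - p)) \<le> \<phi> q" using assms(2) by (simp add: subdifferential_def)
  ultimately have "\<phi> p \<noteq> \<infinity>" by auto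
  moreover have "\<phi> p \<noteq> -\<infinity>" using assms(1) by (simp add: proper_def)
  ultimately show ?thesis by (cases "\<phi> p") auto
qed

lemma subdifferential_monotone:
  assumes "proper \<phi>" "\<xi> \<in> subdifferential \<phi> p" "\<eta> \<in> subdifferential \<phi> q"
  shows "0 \<le> (p - q) \<bullet> (\<xi> - \<eta>)"
proof -
  have "\<phi> p + ereal (\<xi> \<bullet> (q - p)) \<le> \<phi> q" "\<phi> q + ereal (\<eta> \<bullet> (p - q)) \<le> \<phi> p"
    using assms(2,3) by (simp_all add: subdifferential_def)
  moreover obtain a where "\<phi> p = ereal a"
    by (rule that[OF subdifferential_finite[OF assms(1,2)]])
  moreover obtain b where "\<phi> q = ereal b"
    by (rule that[OF subdifferential_finite[OF assms(1,3)]])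
  ultimately have "\<xi> \<bullet> (q - p) + \<eta> \<bullet> (p - q) \<le> 0" by simp
  then show ?thesis by (simp add: inner_diff_left inner_diff_right inner_commute)
qed

section \<open>Strong solutions\<close>

locale strong_solution =
  fixes \<phi> :: "'a::{real_inner, complete_space} \<Rightarrow> ereal" and \<alpha> \<beta> t0 :: real and x y :: "real \<Rightarrow> 'a"
  assumes proper: "proper \<phi>" and lsc: "lsc \<phi>" and convex: "econvex \<phi>"
    and \<alpha>: "\<alpha> > 3" and \<beta>: "\<beta> > 0" and t0: "t0 > 0"
    and solution: "global_strong_solution \<phi> \<alpha> \<beta> t0 x y"
begin

section \<open>The irregular times and the system away from them\<close>

definition exceptional :: "real set" where
  "exceptional = {t. t0 < t \<and> \<not> system_holds_at \<phi> \<alpha> \<beta> x y t}"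

definition u :: "real \<Rightarrow> 'a" where
  "u t = (1 / \<beta> - \<alpha> / t) *\<^sub>R x t - (1 / \<beta>) *\<^sub>R y t"

text \<open>\<open>real_of_ereal\<close> sends infinite values to 0, so \<open>g\<close> carries
  information only where \<open>\<phi> (x t)\<close> is finite; \<open>g_finite\<close> secures this
  from any regular time onwards.\<close>

definition g :: "real \<Rightarrow> real" where
  "g t = real_of_ereal (\<phi> (x t))"

text \<open>The notion of solution gives a null set for each bounded horizon; countably many
  horizons exhaust all times after \<open>t0\<close>.\<close>

lemma negligible_exceptional: "negligible exceptional"
proof -
  have "AE t in lebesgue. t \<in> {t0<..t0 + 1 + real n} \<longrightarrow> system_holds_at \<phi> \<alpha> \<beta> x y t" for n
    using solution unfolding global_strong_solution_def by (auto dest!: spec[of _ "t0 + 1 + real n"])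
  then have "AE t in lebesgue. \<forall>n. t \<in> {t0<..t0 + 1 + real n} \<longrightarrow> system_holds_at \<phi> \<alpha> \<beta> x y t"
    unfolding AE_all_countable by (rule allI)
  then obtain N where N: "N \<in> null_sets lebesgue"
    and holds: "\<And>t. t \<notin> N \<Longrightarrow> \<forall>n. t \<in> {t0<..t0 + 1 + real n} \<longrightarrow> system_holds_at \<phi> \<alpha> \<beta> x y t"
    by (erule_tac AE_E3) auto
  have "exceptional \<subseteq> N"
  proof
    fix t assume t: "t \<in> exceptional"
    obtain n where "t - t0 - 1 \<le> real n" using real_arch_simple by blast
    then have "t \<in> {t0<..t0 + 1 + real n}" using t by (simp add: exceptional_def)
    then show "t \<in> N" using holds[of t] t unfolding exceptional_def by blast
  qed
  then show ?thesis using N negligible_iff_null_sets negligible_subset by blast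
qed

text \<open>A null set contains no nonempty open interval. Hence regular times are dense and can
  serve as starting points and as approximations.\<close>

lemma good_between:
  assumes "c < d"
  obtains t where "c < t" "t < d" "t \<notin> exceptional"
proof -
  have "\<not> negligible {c<..<d}" using assms by (intro open_not_negligible) auto
  then have "\<not> {c<..<d} \<subseteq> exceptional" using negligible_exceptional negligible_subset by blast
  then obtain t where "t \<in> {c<..<d}" "t \<notin> exceptional" by blast
  then show ?thesis using that[of t] by simp
qed

text \<open>Both relations solved for the derivatives; \<open>u\<close> absorbs the linear terms
  that they share.\<close>

lemma system_data:
  assumes "t0 < t" "t \<notin> exceptional"
  obtains \<xi> where "\<xi> \<in> subdifferential \<phi> (x t)"
    and "(x has_vector_derivative (u t - \<beta> *\<^sub>R \<xi>)) (at t)"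
    and "(y has_vector_derivative (u t + (\<alpha> * \<beta> / t\<^sup>2) *\<^sub>R x t)) (at t)"
proof -
  obtain x' y' \<xi> where h: "(x has_vector_derivative x') (at t)" "(y has_vector_derivative y') (at t)"
    "\<xi> \<in> subdifferential \<phi> (x t)"
    "0 = x' + \<beta> *\<^sub>R \<xi> - (1 / \<beta> - \<alpha> / t) *\<^sub>R x t + (1 / \<beta>) *\<^sub>R y t"
    "y' - (1 / \<beta> - \<alpha> / t + \<alpha> * \<beta> / t\<^sup>2) *\<^sub>R x t + (1 / \<beta>) *\<^sub>R y t = 0"
    using assms unfolding exceptional_def system_holds_at_def by auto
  have "x' = u t - \<beta> *\<^sub>R \<xi>" using h(4) unfolding u_def by (simp add: algebra_simps)
  moreover have "y' = u t + (\<alpha> * \<beta> / t\<^sup>2) *\<^sub>R x t"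
    using h(5) unfolding u_def by (simp add: algebra_simps)
  ultimately show ?thesis using that h(1-3) by simp
qed

section \<open>Continuity and Lipschitz bounds along the trajectory\<close>

lemma abs_continuous_xy:
  assumes "t0 < a"
  shows "abs_continuous_on {a..b} x" "abs_continuous_on {a..b} y"
proof -
  \<comment> \<open>The horizon has to exceed \<open>t0\<close> even when \<open>b < a\<close>,
    hence the maximum.\<close>
  have "abs_continuous_on {a..max a b} (\<lambda>t. (x t, y t))"
  proof -
    have "compact {a..max a b} \<and> {a..max a b} \<subseteq> {t0<..max a b}" "t0 < max a b" using assms by auto
    then show ?thesis using solution unfolding global_strong_solution_def by blast
  qed
  then have *: "abs_continuous_on {a..b} (\<lambda>t. (x t, y t))"
    by (rule abs_continuous_on_subset) auto
  show "abs_continuous_on {a..b} x" "abs_continuous_on {a..b} y"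
    by (rule abs_continuous_on_dominated[OF *, where K = 1]; simp add: dist_Pair_Pair)+
qed

lemma continuous_xyu:
  assumes "t0 < a"
  shows "continuous_on {a..b} x" "continuous_on {a..b} y" "continuous_on {a..b} u"
proof -
  show x: "continuous_on {a..b} x" and y: "continuous_on {a..b} y"
    using abs_continuous_xy[OF assms] by (auto intro: abs_continuous_on_imp_continuous_on)
  show "continuous_on {a..b} u"
    unfolding u_def using t0 \<beta> assms by (intro continuous_intros x y) auto
qed

text \<open>Off a null set the derivative of \<open>y\<close> is a continuous function of time free
  of subgradients, hence bounded on \<open>{a..b}\<close>.\<close>

lemma y_lipschitz:
  assumes "t0 < a"
  obtains M where "M \<ge> 0" "\<And>s t. a \<le> s \<Longrightarrow> s \<le> t \<Longrightarrow> t \<le> b \<Longrightarrow> norm (y t - y s) \<le> M * (t - s)"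
proof -
  have "continuous_on {a..b} (\<lambda>t. u t + (\<alpha> * \<beta> / t\<^sup>2) *\<^sub>R x t)"
    using t0 assms by (intro continuous_intros continuous_xyu) auto
  then have "bounded ((\<lambda>t. u t + (\<alpha> * \<beta> / t\<^sup>2) *\<^sub>R x t) ` {a..b})"
    by (intro compact_imp_bounded compact_continuous_image) auto
  then obtain M where M: "\<forall>t\<in>{a..b}. norm (u t + (\<alpha> * \<beta> / t\<^sup>2) *\<^sub>R x t) \<le> M"
    unfolding bounded_iff by blast
  have "norm (y t - y s) \<le> max 0 M * (t - s)" if st: "a \<le> s" "s \<le> t" "t \<le> b" for s t
  proof (rule abs_continuous_on_lipschitz_bound[OF _ st(2) _ negligible_exceptional])
    show "abs_continuous_on {s..t} y" using assms st by (intro abs_continuous_xy) auto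
    fix r assume r: "r \<in> {s..t} - exceptional"
    then have "t0 < r" "r \<notin> exceptional" "r \<in> {a..b}" using assms st by auto
    from system_data[OF this(1,2)] this(3) M
    show "\<exists>d. (y has_vector_derivative d) (at r) \<and> norm d \<le> max 0 M"
      by (metis max.coboundedI2)
  qed simp
  then show ?thesis using that[of "max 0 M"] by simp
qed

text \<open>Prepares the Gronwall argument for \<open>x\<close>: the increments of \<open>x\<close>
  stay on the right-hand side because no Lipschitz bound for them is available yet.\<close>

lemma u_lipschitz:
  assumes "t0 < a"
  obtains C L where "C \<ge> 0" "L \<ge> 0"
    "\<And>s t. a \<le> s \<Longrightarrow> s \<le> t \<Longrightarrow> t \<le> b \<Longrightarrow> norm (u t - u s) \<le> L * norm (x t - x s) + C * (t - s)"
proof -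
  have apos: "a > 0" using assms t0 by simp
  obtain M where M: "M \<ge> 0" "\<And>s t. a \<le> s \<Longrightarrow> s \<le> t \<Longrightarrow> t \<le> b \<Longrightarrow> norm (y t - y s) \<le> M * (t - s)"
    using y_lipschitz[OF assms] by blast
  have "bounded (x ` {a..b})"
    using continuous_xyu[OF assms] by (intro compact_imp_bounded compact_continuous_image) auto
  then obtain B where B: "\<forall>t\<in>{a..b}. norm (x t) \<le> B" unfolding bounded_iff by blast
  define C where "C = \<alpha> / a\<^sup>2 * \<bar>B\<bar> + 1 / \<beta> * M"
  define L where "L = 1 / \<beta> + \<alpha> / a"
  show ?thesis
  proof (rule that[of C L])
    show "C \<ge> 0" and L: "L \<ge> 0" using \<alpha> \<beta> apos M(1) by (auto simp: C_def L_def)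
    fix s t assume st: "a \<le> s" "s \<le> t" "t \<le> b"
    have "u t - u s = (1 / \<beta> - \<alpha> / t) *\<^sub>R (x t - x s) + (\<alpha> / s - \<alpha> / t) *\<^sub>R x s - (1 / \<beta>) *\<^sub>R (y t - y s)"
      by (simp add: u_def algebra_simps)
    also have "norm \<dots> \<le> \<bar>1 / \<beta> - \<alpha> / t\<bar> * norm (x t - x s) + \<bar>\<alpha> / s - \<alpha> / t\<bar> * norm (x s) + 1 / \<beta> * norm (y t - y s)"
      using \<beta> by (intro norm_triangle_le_diff order_trans[OF norm_triangle_ineq4] add_mono norm_triangle_le) auto
    also have "\<dots> \<le> L * norm (x t - x s) + (\<alpha> / a\<^sup>2 * (t - s)) * \<bar>B\<bar> + 1 / \<beta> * (M * (t - s))"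
    proof (intro add_mono mult_mono mult_right_mono mult_left_mono)
      have "\<alpha> / t \<le> \<alpha> / a" using st apos \<alpha> by (intro divide_left_mono) auto
      moreover have "0 \<le> \<alpha> / t" "0 \<le> 1 / \<beta>" using st apos \<alpha> \<beta> by auto
      ultimately show "\<bar>1 / \<beta> - \<alpha> / t\<bar> \<le> L" unfolding L_def by linarith
      have "\<alpha> / s - \<alpha> / t = \<alpha> * (t - s) / (s * t)" using st apos by (simp add: field_simps)
      moreover have "\<alpha> * (t - s) / (s * t) \<le> \<alpha> * (t - s) / a\<^sup>2"
        unfolding power2_eq_square using st apos \<alpha> by (intro divide_left_mono mult_mono) auto
      moreover have "0 \<le> \<alpha> * (t - s) / (s * t)" using st apos \<alpha> by auto
      ultimately show "\<bar>\<alpha> / s - \<alpha> / t\<bar> \<le> \<alpha> / a\<^sup>2 * (t - s)" by (simp add: ac_simps)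
      show "norm (x s) \<le> \<bar>B\<bar>" using B st by force
      show "norm (y t - y s) \<le> M * (t - s)" using M st by simp
    qed (use \<alpha> \<beta> st L in auto)
    finally show "norm (u t - u s) \<le> L * norm (x t - x s) + C * (t - s)"
      by (simp add: C_def algebra_simps add_divide_distrib diff_divide_distrib)
  qed
qed

text \<open>By monotonicity of the subdifferential, \<open>d(t) = \<parallel>x(t + h) - x(t)\<parallel>\<^sup>2\<close> satisfies
  \<open>d' \<le> (2L + 1) d + C\<^sup>2h\<^sup>2\<close>, and \<open>d(s) = O(h\<^sup>2)\<close> at a point \<open>s\<close> of differentiability.\<close>

lemma x_lipschitz:
  assumes s: "t0 < s" "s \<notin> exceptional"
  obtains K where "K \<ge> 0" "\<And>p q. s \<le> p \<Longrightarrow> p \<le> q \<Longrightarrow> q \<le> b \<Longrightarrow> norm (x q - x p) \<le> K * (q - p)"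
proof -
  \<comment> \<open>The bound reaches \<open>b + 1\<close> to leave room for the shifted times
    \<open>t + h\<close> with \<open>h < 1\<close>.\<close>
  obtain C L where C: "C \<ge> 0" and L: "L \<ge> 0" and u_le:
    "\<And>p q. s \<le> p \<Longrightarrow> p \<le> q \<Longrightarrow> q \<le> b + 1 \<Longrightarrow> norm (u q - u p) \<le> L * norm (x q - x p) + C * (q - p)"
    using u_lipschitz[OF s(1), of "b + 1"] by blast
  define c where "c = 2 * L + 1"
  obtain v where v: "(x has_vector_derivative v) (at s)" using system_data[OF s] by blast
  define B where "B = norm v + 1"
  have "\<forall>\<^sub>F h in at_right 0. norm (x (s + h) - x s) / h < B"
    by (rule order_tendstoD(2)[OF has_vector_derivative_norm_quotient[OF v]]) (simp add: B_def)
  then obtain h0 where h0: "h0 > 0" "\<And>h. 0 < h \<Longrightarrow> h < h0 \<Longrightarrow> norm (x (s + h) - x s) / h < B"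
    by (auto simp: eventually_at_right_field)
  \<comment> \<open>The value of \<open>d + C\<^sup>2 * h\<^sup>2\<close> at \<open>s\<close> is at
    most \<open>(B\<^sup>2 + C\<^sup>2) * h\<^sup>2\<close>, and up to \<open>b\<close> it grows at
    most by the factor \<open>exp (c * (b - s))\<close>.\<close>
  define K where "K = sqrt (exp (c * (b - s)) * (B\<^sup>2 + C\<^sup>2))"
  have step: "norm (x (t + h) - x t) \<le> K * h" if t: "s \<le> t" "t \<le> b" and h: "0 < h" "h < min h0 1" for t h
  proof -
    define d where "d r = (x (r + h) - x r) \<bullet> (x (r + h) - x r)" for r
    define f where "f r = exp (- c * r) * (d r + C\<^sup>2 * h\<^sup>2)" for r
    \<comment> \<open>Both \<open>r\<close> and \<open>r + h\<close> have to be regular, so the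
      translated null set is removed as well.\<close>
    have neg: "negligible (exceptional \<union> (+) (- h) ` exceptional)"
      using negligible_exceptional by (intro negligible_Un negligible_translation)
    have "f t \<le> f s"
    proof (rule abs_continuous_on_antimono[OF _ t(1) neg])
      have xs: "abs_continuous_on {s..t} x" using s(1) by (rule abs_continuous_xy)
      have "abs_continuous_on {s..t} (\<lambda>r. x (r + h))"
        using s(1) h by (intro abs_continuous_on_shift abs_continuous_xy) simp
      from abs_continuous_on_diff[OF this xs]
      have dx: "abs_continuous_on {s..t} (\<lambda>r. x (r + h) - x r)" .
      have e: "abs_continuous_on {s..t} (\<lambda>r. exp (- c * r))"
        by (rule abs_continuous_on_C1[where f' = "\<lambda>r. - c * exp (- c * r)"])
           (auto intro!: derivative_eq_intros continuous_intros simp flip: has_real_derivative_iff_has_vector_derivative)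
      show "abs_continuous_on {s..t} f"
        unfolding f_def d_def
        by (intro bounded_bilinear.abs_continuous_on[OF bounded_bilinear_mult] e abs_continuous_on_add
            bounded_bilinear.abs_continuous_on[OF bounded_bilinear_inner] dx abs_continuous_on_const)
    next
      fix r assume r: "r \<in> {s..t} - (exceptional \<union> (+) (- h) ` exceptional)"
      have "r + h \<notin> exceptional"
      proof
        assume "r + h \<in> exceptional"
        then have "- h + (r + h) \<in> (+) (- h) ` exceptional" by (rule imageI)
        then show False using r by simp
      qed
      then have r': "t0 < r" "r \<notin> exceptional" "t0 < r + h" "r + h \<notin> exceptional" using r s(1) h by auto
      obtain \<xi> where \<xi>: "\<xi> \<in> subdifferential \<phi> (x r)" "(x has_vector_derivative u r - \<beta> *\<^sub>R \<xi>) (at r)"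
        using system_data[OF r'(1,2)] by blast
      obtain \<eta> where \<eta>: "\<eta> \<in> subdifferential \<phi> (x (r + h))"
        "(x has_vector_derivative u (r + h) - \<beta> *\<^sub>R \<eta>) (at (r + h))"
        using system_data[OF r'(3,4)] by blast
      define D where "D = x (r + h) - x r"
      define w where "w = (u (r + h) - \<beta> *\<^sub>R \<eta>) - (u r - \<beta> *\<^sub>R \<xi>)"
      have "((\<lambda>r. r + h) has_vector_derivative 1) (at r)"
        by (auto intro!: derivative_eq_intros simp flip: has_real_derivative_iff_has_vector_derivative)
      from vector_diff_chain_at[OF this \<eta>(2)]
      have "((\<lambda>r. x (r + h)) has_vector_derivative u (r + h) - \<beta> *\<^sub>R \<eta>) (at r)"
        by (simp add: o_def)
      then have "((\<lambda>r. x (r + h) - x r) has_vector_derivative w) (at r)"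
        unfolding w_def using \<xi>(2) by (rule has_vector_derivative_diff)
      from bounded_bilinear.has_vector_derivative[OF bounded_bilinear_inner this this]
      have "(d has_real_derivative 2 * (D \<bullet> w)) (at r)"
        unfolding d_def D_def has_real_derivative_iff_has_vector_derivative by (simp add: inner_commute)
      then have f: "(f has_real_derivative exp (- c * r) * (2 * (D \<bullet> w) - c * (d r + C\<^sup>2 * h\<^sup>2))) (at r)"
        unfolding f_def by (auto intro!: derivative_eq_intros simp: algebra_simps)
      \<comment> \<open>The subgradients enter only through the term with
        \<open>\<eta> - \<xi>\<close>, which monotonicity allows to be dropped; the rest is
        controlled by the increment of \<open>u\<close>.\<close>
      have "D \<bullet> w = D \<bullet> (u (r + h) - u r) - \<beta> * (D \<bullet> (\<eta> - \<xi>))"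
        by (simp add: w_def inner_diff_right algebra_simps)
      also have "\<dots> \<le> D \<bullet> (u (r + h) - u r)"
        using \<beta> subdifferential_monotone[OF proper \<eta>(1) \<xi>(1)] by (simp add: D_def)
      also have "\<dots> \<le> norm D * norm (u (r + h) - u r)" by (rule norm_cauchy_schwarz)
      also have "\<dots> \<le> norm D * (L * norm D + C * h)"
        using u_le[of r "r + h"] r t h by (intro mult_left_mono) (auto simp: D_def)
      finally have "2 * (D \<bullet> w) \<le> 2 * L * (norm D)\<^sup>2 + 2 * (norm D * (C * h))"
        by (simp add: algebra_simps power2_eq_square)
      also have "2 * (norm D * (C * h)) \<le> (norm D)\<^sup>2 + (C * h)\<^sup>2"
        using sum_squares_bound[of "norm D" "C * h"] by simp
      also have "2 * L * (norm D)\<^sup>2 + ((norm D)\<^sup>2 + (C * h)\<^sup>2) \<le> c * (d r + C\<^sup>2 * h\<^sup>2)"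
        using L by (simp add: c_def d_def D_def power2_norm_eq_inner algebra_simps power_mult_distrib)
      finally have "exp (- c * r) * (2 * (D \<bullet> w) - c * (d r + C\<^sup>2 * h\<^sup>2)) \<le> 0"
        by (simp add: mult_nonneg_nonpos)
      with f show "\<exists>F d. (F has_real_derivative d) (at r) \<and> d \<le> 0 \<and> F r = f r \<and> (\<forall>q\<in>{s..t}. F q \<le> f q)"
        by blast
    qed
    have "norm (x (s + h) - x s) \<le> B * h" using h0(2)[of h] h by (simp add: pos_divide_less_eq less_imp_le)
    then have "(norm (x (s + h) - x s))\<^sup>2 \<le> (B * h)\<^sup>2" by (intro power_mono) auto
    then have ds: "d s \<le> B\<^sup>2 * h\<^sup>2" by (simp add: d_def power2_norm_eq_inner power_mult_distrib)
    have "d t + C\<^sup>2 * h\<^sup>2 = exp (c * t) * f t"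
      by (simp add: f_def exp_minus field_simps)
    also have "\<dots> \<le> exp (c * t) * f s" using \<open>f t \<le> f s\<close> by simp
    also have "\<dots> = exp (c * (t - s)) * (d s + C\<^sup>2 * h\<^sup>2)"
      by (simp add: f_def exp_minus exp_diff right_diff_distrib field_simps)
    also have "\<dots> \<le> exp (c * (b - s)) * (B\<^sup>2 * h\<^sup>2 + C\<^sup>2 * h\<^sup>2)"
      using ds t L by (intro mult_mono add_mono) (auto simp: c_def d_def)
    also have "\<dots> = (exp (c * (b - s)) * (B\<^sup>2 + C\<^sup>2)) * h\<^sup>2" by (simp add: algebra_simps)
    also have "\<dots> = (K * h)\<^sup>2"
      unfolding K_def power_mult_distrib by (subst real_sqrt_pow2) (auto intro!: mult_nonneg_nonneg)
    finally have "(norm (x (t + h) - x t))\<^sup>2 \<le> (K * h)\<^sup>2"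
      unfolding d_def power2_norm_eq_inner by (smt (verit) zero_le_power2 mult_nonneg_nonneg)
    then show ?thesis
      by (rule power2_le_imp_le) (use h in \<open>auto simp: K_def\<close>)
  qed
  \<comment> \<open>\<open>step\<close> covers only short increments. It bounds the derivative at
    regular times by \<open>K\<close>, which then gives the bound on all of
    \<open>{p..q}\<close>.\<close>
  have "norm (x q - x p) \<le> K * (q - p)" if pq: "s \<le> p" "p \<le> q" "q \<le> b" for p q
  proof (rule abs_continuous_on_lipschitz_bound[OF _ pq(2) _ negligible_exceptional])
    show "abs_continuous_on {p..q} x" using s pq by (intro abs_continuous_xy) auto
    show "0 \<le> K" by (simp add: K_def)
    fix r assume r: "r \<in> {p..q} - exceptional"
    then obtain v where v: "(x has_vector_derivative v) (at r)"
      using system_data[of r] s pq by auto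
    have "\<forall>\<^sub>F h in at_right 0. h < min h0 1"
      using h0(1) by (intro order_tendstoD(2)[OF tendsto_ident_at]) simp
    then have "\<forall>\<^sub>F h in at_right 0. norm (x (r + h) - x r) / h \<le> K"
      using eventually_at_right_less[of 0]
    proof eventually_elim
      case (elim h)
      then show ?case using step[of r h] r pq by (simp add: pos_divide_le_eq)
    qed
    then have "norm v \<le> K"
      by (intro tendsto_upperbound[OF has_vector_derivative_norm_quotient[OF v]]) auto
    with v show "\<exists>d. (x has_vector_derivative d) (at r) \<and> norm d \<le> K" by blast
  qed
  then show ?thesis using that[of K] by (simp add: K_def)
qed

text \<open>At a regular time \<open>\<beta> *\<^sub>R \<xi>\<close> is the difference of
  \<open>u t\<close>, bounded by continuity, and the derivative of \<open>x\<close>, bounded by the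
  Lipschitz constant.\<close>

lemma bounded_subgradient:
  assumes s: "t0 < s" "s \<notin> exceptional"
  obtains M where "M \<ge> 0"
    and "\<And>p q. s \<le> p \<Longrightarrow> p \<le> q \<Longrightarrow> q \<le> b \<Longrightarrow> norm (x q - x p) \<le> M * (q - p)"
    and "\<And>t. s \<le> t \<Longrightarrow> t \<le> b \<Longrightarrow> t \<notin> exceptional \<Longrightarrow> \<exists>\<xi>\<in>subdifferential \<phi> (x t). norm \<xi> \<le> M"
proof -
  obtain K where K: "K \<ge> 0"
    "\<And>p q. s \<le> p \<Longrightarrow> p \<le> q \<Longrightarrow> q \<le> b + 1 \<Longrightarrow> norm (x q - x p) \<le> K * (q - p)"
    using x_lipschitz[OF s, of "b + 1"] by blast
  have "bounded (u ` {s..b})"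
    using continuous_xyu[OF s(1)] by (intro compact_imp_bounded compact_continuous_image) auto
  then obtain U where U: "\<forall>t\<in>{s..b}. norm (u t) \<le> U" unfolding bounded_iff by blast
  define M where "M = max K ((K + \<bar>U\<bar>) / \<beta>)"
  show ?thesis
  proof (rule that[of M])
    show "M \<ge> 0" using K(1) by (simp add: M_def)
    fix p q assume pq: "s \<le> p" "p \<le> q" "q \<le> b"
    have "norm (x q - x p) \<le> K * (q - p)" using K(2) pq by simp
    also have "\<dots> \<le> M * (q - p)" using pq by (intro mult_right_mono) (auto simp: M_def)
    finally show "norm (x q - x p) \<le> M * (q - p)" .
  next
    fix t assume t: "s \<le> t" "t \<le> b" "t \<notin> exceptional"
    then obtain \<xi> where \<xi>: "\<xi> \<in> subdifferential \<phi> (x t)" "(x has_vector_derivative (u t - \<beta> *\<^sub>R \<xi>)) (at t)"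
      using system_data[of t] s by auto
    have "\<forall>\<^sub>F h in at_right 0. h < (1::real)" by (rule order_tendstoD(2)[OF tendsto_ident_at]) simp
    then have "\<forall>\<^sub>F h in at_right 0. norm (x (t + h) - x t) / h \<le> K"
      using eventually_at_right_less[of 0]
    proof eventually_elim
      case (elim h)
      then show ?case using K(2)[of t "t + h"] t by (simp add: pos_divide_le_eq)
    qed
    then have "norm (u t - \<beta> *\<^sub>R \<xi>) \<le> K"
      by (intro tendsto_upperbound[OF has_vector_derivative_norm_quotient[OF \<xi>(2)]]) auto
    moreover have "norm (\<beta> *\<^sub>R \<xi>) \<le> norm (u t - \<beta> *\<^sub>R \<xi>) + norm (u t)"
      by (metis add.commute diff_add_cancel norm_minus_commute norm_triangle_sub)
    moreover have "norm (u t) \<le> \<bar>U\<bar>" using U t by force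
    ultimately have "\<beta> * norm \<xi> \<le> K + \<bar>U\<bar>" using \<beta> by simp
    then have "norm \<xi> \<le> (K + \<bar>U\<bar>) / \<beta>" using \<beta> by (simp add: pos_le_divide_eq mult.commute)
    then have "norm \<xi> \<le> M" by (simp add: M_def)
    with \<xi>(1) show "\<exists>\<xi>\<in>subdifferential \<phi> (x t). norm \<xi> \<le> M" by blast
  qed
qed

text \<open>A subgradient at a regular time bounds \<open>\<phi> (x t)\<close> from below at every
  \<open>t\<close>. Lower semicontinuity, applied along regular times tending to \<open>t\<close>
  from the right, gives the matching upper bound, also at exceptional \<open>t\<close>.\<close>

lemma g_finite_lipschitz:
  assumes s: "t0 < s" "s \<notin> exceptional"
  obtains M where "\<And>t. s \<le> t \<Longrightarrow> t \<le> b \<Longrightarrow> \<phi> (x t) = ereal (g t)"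
    and "\<And>p q. s \<le> p \<Longrightarrow> p \<le> q \<Longrightarrow> q \<le> b \<Longrightarrow> \<bar>g q - g p\<bar> \<le> M * (q - p)"
proof -
  obtain K where K: "K \<ge> 0"
    and x_le: "\<And>p q. s \<le> p \<Longrightarrow> p \<le> q \<Longrightarrow> q \<le> b + 1 \<Longrightarrow> norm (x q - x p) \<le> K * (q - p)"
    and sub: "\<And>t. s \<le> t \<Longrightarrow> t \<le> b + 1 \<Longrightarrow> t \<notin> exceptional \<Longrightarrow> \<exists>\<xi>\<in>subdifferential \<phi> (x t). norm \<xi> \<le> K"
    using bounded_subgradient[OF s, of "b + 1"] by blast
  have x_abs: "norm (x q - x p) \<le> K * \<bar>q - p\<bar>" if "p \<in> {s..b+1}" "q \<in> {s..b+1}" for p q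
    using x_le[of p q] x_le[of q p] that by (cases "p \<le> q") (auto simp: norm_minus_commute)
  define M where "M = K * K"
  have good: "\<phi> (x r) = ereal (g r)" if "r \<in> {s..b+1} - exceptional" for r
    using sub[of r] that subdifferential_finite[OF proper] unfolding g_def by auto
  have lower: "ereal (g r - M * \<bar>t - r\<bar>) \<le> \<phi> (x t)" if r: "r \<in> {s..b+1} - exceptional" and t: "t \<in> {s..b+1}" for r t
  proof -
    obtain \<xi> where \<xi>: "\<xi> \<in> subdifferential \<phi> (x r)" "norm \<xi> \<le> K" using sub[of r] r by auto
    have "\<bar>\<xi> \<bullet> (x t - x r)\<bar> \<le> norm \<xi> * norm (x t - x r)" by (rule Cauchy_Schwarz_ineq2)
    also have "\<dots> \<le> K * (K * \<bar>t - r\<bar>)" using \<xi>(2) x_abs[of r t] r t K by (intro mult_mono) auto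
    finally have "g r - M * \<bar>t - r\<bar> \<le> g r + \<xi> \<bullet> (x t - x r)" by (simp add: M_def)
    then have "ereal (g r - M * \<bar>t - r\<bar>) \<le> \<phi> (x r) + ereal (\<xi> \<bullet> (x t - x r))" by (simp add: good[OF r])
    also have "\<dots> \<le> \<phi> (x t)" using \<xi>(1) by (simp add: subdifferential_def)
    finally show ?thesis .
  qed
  have upper: "\<phi> (x t) \<le> ereal (g r + M * \<bar>t - r\<bar>)" if r: "r \<in> {s..b+1} - exceptional" and t: "t \<in> {s..b}" for r t
  proof (rule ereal_le_epsilon2)
    fix e :: real assume "e > 0"
    let ?c = "ereal (g r + M * \<bar>t - r\<bar> + e)"
    have "x t \<in> closure {p. \<phi> p \<le> ?c}"
      unfolding closure_approachable
    proof (intro allI impI)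
      fix \<epsilon> :: real assume "\<epsilon> > 0"
      \<comment> \<open>The three bounds keep \<open>r'\<close> within \<open>{s..b+1}\<close>, make
        \<open>M * (r' - t)\<close> at most \<open>e\<close>, and make \<open>x r'\<close> closer to
        \<open>x t\<close> than \<open>\<epsilon>\<close>.\<close>
      define \<delta> where "\<delta> = min 1 (min (e / (M + 1)) (\<epsilon> / (K + 1)))"
      have "M \<ge> 0" using K by (simp add: M_def)
      then have "\<delta> > 0" using K \<open>e > 0\<close> \<open>\<epsilon> > 0\<close> by (simp add: \<delta>_def)
      then obtain r' where r': "t < r'" "r' < t + \<delta>" "r' \<notin> exceptional" using good_between[of t "t + \<delta>"] by auto
      have d: "r' - t \<le> 1" "r' - t \<le> e / (M + 1)" "r' - t < \<epsilon> / (K + 1)" using r' by (auto simp: \<delta>_def)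
      have in_r': "r' \<in> {s..b+1} - exceptional" using r' t d by auto
      have "g r' - M * \<bar>r - r'\<bar> \<le> g r" using lower[OF in_r', of r] good[OF r] r by simp
      moreover have "M * \<bar>r - r'\<bar> \<le> M * (\<bar>t - r\<bar> + (r' - t))"
        using \<open>M \<ge> 0\<close> r' by (intro mult_left_mono) auto
      moreover have "M * (r' - t) \<le> (M + 1) * (e / (M + 1))"
        using \<open>M \<ge> 0\<close> d(2) r' by (intro mult_mono) auto
      then have "M * (r' - t) \<le> e" using \<open>M \<ge> 0\<close> by simp
      ultimately have "g r' \<le> g r + M * \<bar>t - r\<bar> + e" by (simp add: distrib_left)
      then have "\<phi> (x r') \<le> ?c" using good[OF in_r'] by simp
      moreover have "dist (x r') (x t) < \<epsilon>"
      proof -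
        have "dist (x r') (x t) \<le> K * (r' - t)"
          using x_abs[of t r'] t in_r' r' by (simp add: dist_norm)
        also have "\<dots> \<le> (K + 1) * (r' - t)" using r' by (intro mult_right_mono) auto
        also have "\<dots> < \<epsilon>" using d(3) K by (simp add: pos_less_divide_eq mult.commute)
        finally show ?thesis .
      qed
      ultimately show "\<exists>p\<in>{p. \<phi> p \<le> ?c}. dist p (x t) < \<epsilon>" by blast
    qed
    then show "\<phi> (x t) \<le> ereal (g r + M * \<bar>t - r\<bar>) + ereal e"
      using closure_closed[OF lsc_closed_sublevel[OF lsc]] by simp
  qed
  have fin: "\<phi> (x t) = ereal (g t)" if t: "t \<in> {s..b}" for t
  proof -
    obtain r where r: "t < r" "r < t + 1" "r \<notin> exceptional" using good_between[of t "t + 1"] by auto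
    then have "r \<in> {s..b+1} - exceptional" using t by auto
    from lower[OF this, of t] upper[OF this t] t show ?thesis unfolding g_def by (cases "\<phi> (x t)") auto
  qed
  have lip: "\<bar>g t - g r\<bar> \<le> M * \<bar>t - r\<bar>" if r: "r \<in> {s..b+1} - exceptional" and t: "t \<in> {s..b}" for r t
    using lower[OF r, of t] upper[OF r t] fin[OF t] t by simp
  have "\<bar>g q - g p\<bar> \<le> M * (q - p)" if pq: "s \<le> p" "p \<le> q" "q \<le> b" for p q
  proof (cases "p = q")
    case False
    \<comment> \<open>The estimate \<open>lip\<close> needs one regular argument. For
      \<open>r\<close> between \<open>p\<close> and \<open>q\<close> the two bounds add up to
      exactly \<open>M * (q - p)\<close>.\<close>
    then obtain r where r: "p < r" "r < q" "r \<notin> exceptional" using good_between[of p q] pq by auto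
    then have "r \<in> {s..b+1} - exceptional" using pq by auto
    from lip[OF this, of p] lip[OF this, of q] r pq
    have "\<bar>g p - g r\<bar> \<le> M * (r - p)" "\<bar>g q - g r\<bar> \<le> M * (q - r)" by auto
    then show ?thesis by (simp add: algebra_simps)
  qed simp
  with fin that[of M] show ?thesis by simp
qed

lemma g_finite:
  assumes s: "t0 < s" "s \<notin> exceptional" and "s \<le> t"
  shows "\<phi> (x t) = ereal (g t)"
proof (rule g_finite_lipschitz[OF s, of t])
  assume "\<And>r. s \<le> r \<Longrightarrow> r \<le> t \<Longrightarrow> \<phi> (x r) = ereal (g r)"
  from this[OF \<open>s \<le> t\<close> order_refl] show ?thesis .
qed

section \<open>The energy and its monotonicity\<close>

lemma argmin_finite:
  assumes "z \<in> argmin_set \<phi>"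
  shows "\<phi> z = ereal (real_of_ereal (\<phi> z))" and "\<phi> z \<le> \<phi> p"
proof -
  have le: "\<phi> z \<le> \<phi> p" for p
    using assms by (auto simp: argmin_set_def is_arg_min_def not_less)
  then show "\<phi> z \<le> \<phi> p" .
  obtain p where "\<phi> p < \<infinity>" using proper by (auto simp: proper_def edom_def)
  with le[of p] have "\<phi> z \<noteq> \<infinity>" by auto
  moreover have "\<phi> z \<noteq> -\<infinity>" using proper by (simp add: proper_def)
  ultimately show "\<phi> z = ereal (real_of_ereal (\<phi> z))" by (cases "\<phi> z") auto
qed

definition gap :: "'a \<Rightarrow> real \<Rightarrow> real" where
  "gap z t = g t - real_of_ereal (\<phi> z)"

definition energy :: "real \<Rightarrow> 'a \<Rightarrow> real \<Rightarrow> real" where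
  "energy \<mu> z t = t * (t + \<beta> * (\<alpha> - 2 - \<mu>)) * gap z t
    + (norm (\<mu> *\<^sub>R (x t - z) + t *\<^sub>R u t))\<^sup>2 / 2 + \<mu> * (\<alpha> - 1 - \<mu>) / 2 * (norm (x t - z))\<^sup>2"

definition Q :: "real \<Rightarrow> 'a \<Rightarrow> real \<Rightarrow> real" where
  "Q s z t = integral {s..t} (\<lambda>r. (x r - z) \<bullet> u r)"

text \<open>The derivative of \<open>P\<close> is \<open>\<beta> (x - z) \<bullet> \<xi>\<close> with \<open>\<xi>\<close> in the subdifferential at \<open>x\<close>, so \<open>P\<close> plays
  the role of the integral of this (a priori only measurable) function.\<close>

definition P :: "real \<Rightarrow> 'a \<Rightarrow> real \<Rightarrow> real" where
  "P s z t = Q s z t - (norm (x t - z))\<^sup>2 / 2"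

lemma gap_nonneg:
  assumes "t0 < s" "s \<notin> exceptional" "s \<le> t" "z \<in> argmin_set \<phi>"
  shows "0 \<le> gap z t"
proof -
  have "\<phi> (x t) = ereal (g t)" by (rule g_finite[OF assms(1-3)])
  moreover obtain b where "\<phi> z = ereal b"
    by (rule that[OF argmin_finite(1)[OF assms(4)]])
  ultimately show ?thesis using argmin_finite(2)[OF assms(4), of "x t"] by (simp add: gap_def)
qed

lemma gap_le_inner:
  assumes "\<xi> \<in> subdifferential \<phi> (x t)" "z \<in> argmin_set \<phi>"
  shows "gap z t \<le> (x t - z) \<bullet> \<xi>"
proof -
  have "\<phi> (x t) + ereal (\<xi> \<bullet> (z - x t)) \<le> \<phi> z" using assms(1) by (simp add: subdifferential_def)
  moreover obtain a where "\<phi> (x t) = ereal a"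
    by (rule that[OF subdifferential_finite[OF proper assms(1)]])
  moreover obtain b where "\<phi> z = ereal b"
    by (rule that[OF argmin_finite(1)[OF assms(2)]])
  ultimately show ?thesis by (simp add: gap_def g_def inner_diff_left inner_diff_right inner_commute)
qed

text \<open>Differentiating the coefficient of \<open>x\<close> in \<open>u\<close> produces
  \<open>(\<alpha> / t\<^sup>2) *\<^sub>R x t\<close>, which cancels against the corresponding term
  of the derivative of \<open>y\<close>; only \<open>x'\<close> and \<open>\<xi>\<close>
  remain.\<close>

lemma u_derivative:
  assumes "t0 < t" and x': "(x has_vector_derivative x') (at t)" "x' = u t - \<beta> *\<^sub>R \<xi>"
    and y': "(y has_vector_derivative (u t + (\<alpha> * \<beta> / t\<^sup>2) *\<^sub>R x t)) (at t)"
  shows "(u has_vector_derivative (- (\<alpha> / t) *\<^sub>R x' - \<xi>)) (at t)"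
proof -
  have t: "t > 0" using assms(1) t0 by simp
  have "((\<lambda>t. 1 / \<beta> - \<alpha> / t) has_real_derivative \<alpha> / t\<^sup>2) (at t)"
    using t by (auto intro!: derivative_eq_intros simp: power2_eq_square)
  from has_vector_derivative_diff[OF has_vector_derivative_scaleR[OF this x'(1)]
      has_vector_derivative_scaleR[OF DERIV_const y']]
  have *: "(u has_vector_derivative (1 / \<beta> - \<alpha> / t) *\<^sub>R x' + (\<alpha> / t\<^sup>2) *\<^sub>R x t
      - ((1 / \<beta>) *\<^sub>R (u t + (\<alpha> * \<beta> / t\<^sup>2) *\<^sub>R x t) + 0 *\<^sub>R y t)) (at t)"
    unfolding u_def .
  have "u t = x' + \<beta> *\<^sub>R \<xi>" using x'(2) by simp
  then have eq: "(1 / \<beta> - \<alpha> / t) *\<^sub>R x' + (\<alpha> / t\<^sup>2) *\<^sub>R x t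
      - ((1 / \<beta>) *\<^sub>R (u t + (\<alpha> * \<beta> / t\<^sup>2) *\<^sub>R x t) + 0 *\<^sub>R y t) = - (\<alpha> / t) *\<^sub>R x' - \<xi>"
    using \<beta> by (simp add: algebra_simps)
  show ?thesis using * unfolding eq .
qed

lemma Q_derivative:
  assumes "t0 < s" "s < t"
  shows "(Q s z has_real_derivative (x t - z) \<bullet> u t) (at t)"
proof -
  have "continuous_on {s..t + 1} (\<lambda>r. (x r - z) \<bullet> u r)"
    by (intro continuous_intros continuous_xyu assms)
  from integral_has_real_derivative[OF this, of t] assms
  have "(Q s z has_real_derivative (x t - z) \<bullet> u t) (at t within {s..t + 1})"
    unfolding Q_def by simp
  then show ?thesis using at_within_Icc_at[of s t "t + 1"] assms(2) by simp
qed

lemma P_derivative: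
  assumes "t0 < s" "s < t" and x': "(x has_vector_derivative x') (at t)" "x' = u t - \<beta> *\<^sub>R \<xi>"
  shows "(P s z has_real_derivative \<beta> * ((x t - z) \<bullet> \<xi>)) (at t)"
proof -
  have "((\<lambda>t. x t - z) has_vector_derivative x') (at t)"
    using has_vector_derivative_diff[OF x'(1) has_vector_derivative_const] by simp
  from bounded_bilinear.has_vector_derivative[OF bounded_bilinear_inner this this]
  have *: "((\<lambda>t. (norm (x t - z))\<^sup>2) has_real_derivative 2 * ((x t - z) \<bullet> x')) (at t)"
    unfolding has_real_derivative_iff_has_vector_derivative power2_norm_eq_inner by (simp add: inner_commute)
  have eq: "(x t - z) \<bullet> u t - 2 * ((x t - z) \<bullet> x') / 2 = \<beta> * ((x t - z) \<bullet> \<xi>)"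
    by (simp add: x'(2) inner_diff_right diff_divide_distrib)
  from DERIV_diff[OF Q_derivative[OF assms(1,2), of z] DERIV_cdivide[OF *, of 2]]
  show ?thesis unfolding P_def eq .
qed

lemma abs_continuous_regular:
  assumes s: "t0 < s" "s \<notin> exceptional"
  shows "abs_continuous_on {s..b} x" "abs_continuous_on {s..b} u" "abs_continuous_on {s..b} g"
    "abs_continuous_on {s..b} (P s z)" "abs_continuous_on {s..b} (energy \<mu> z)"
proof -
  show x: "abs_continuous_on {s..b} x" by (rule abs_continuous_xy[OF s(1)])
  have f: "abs_continuous_on {s..b} (\<lambda>t. 1 / \<beta> - \<alpha> / t)"
  proof (rule abs_continuous_on_C1[where f' = "\<lambda>t. \<alpha> / t\<^sup>2"])
    show "((\<lambda>t. 1 / \<beta> - \<alpha> / t) has_vector_derivative \<alpha> / t\<^sup>2) (at t within {s..b})" if "t \<in> {s..b}" for t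
      unfolding has_real_derivative_iff_has_vector_derivative[symmetric]
      using that s(1) t0 by (auto intro!: derivative_eq_intros simp: power2_eq_square)
    show "continuous_on {s..b} (\<lambda>t. \<alpha> / t\<^sup>2)" using s(1) t0 by (intro continuous_intros) auto
  qed
  show u: "abs_continuous_on {s..b} u"
    unfolding u_def
    by (rule abs_continuous_on_diff[OF bounded_bilinear.abs_continuous_on[OF bounded_bilinear_scaleR f x]
        bounded_bilinear.abs_continuous_on[OF bounded_bilinear_scaleR abs_continuous_on_const abs_continuous_xy(2)[OF s(1)]]])
  show g: "abs_continuous_on {s..b} g"
  proof (rule g_finite_lipschitz[OF s, of b])
    fix M assume M: "\<And>p q. s \<le> p \<Longrightarrow> p \<le> q \<Longrightarrow> q \<le> b \<Longrightarrow> \<bar>g q - g p\<bar> \<le> M * (q - p)"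
    show ?thesis
    proof (rule abs_continuous_on_lipschitz[where L = M])
      fix p q assume "p \<in> {s..b}" "q \<in> {s..b}" "p \<le> q"
      then show "dist (g p) (g q) \<le> M * (q - p)"
        using M[of p q] by (simp add: dist_real_def)
    qed
  qed
  have "abs_continuous_on {s..b} (\<lambda>t. integral {s..t} (\<lambda>r. (x r - z) \<bullet> u r))"
  proof (rule abs_continuous_on_C1[where f' = "\<lambda>r. (x r - z) \<bullet> u r"])
    show c: "continuous_on {s..b} (\<lambda>r. (x r - z) \<bullet> u r)"
      by (intro continuous_on_inner continuous_on_diff continuous_on_const continuous_xyu[OF s(1)])
    show "((\<lambda>t. integral {s..t} (\<lambda>r. (x r - z) \<bullet> u r)) has_vector_derivative (x t - z) \<bullet> u t)
        (at t within {s..b})" if "t \<in> {s..b}" for t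
      by (rule integral_has_vector_derivative[OF c that])
  qed
  note Q = this
  note mult = bounded_bilinear.abs_continuous_on[OF bounded_bilinear_mult, of s b]
  note scaleR = bounded_bilinear.abs_continuous_on[OF bounded_bilinear_scaleR, of s b]
  note inner = bounded_bilinear.abs_continuous_on[OF bounded_bilinear_inner, of s b]
  note const = abs_continuous_on_const[of "{s..b}"]
  have xz: "abs_continuous_on {s..b} (\<lambda>t. x t - z)" by (rule abs_continuous_on_diff[OF x const])
  have v: "abs_continuous_on {s..b} (\<lambda>t. \<mu> *\<^sub>R (x t - z) + t *\<^sub>R u t)"
    by (rule abs_continuous_on_add[OF scaleR[OF const xz] scaleR[OF abs_continuous_on_id u]])
  have n: "abs_continuous_on {s..b} (\<lambda>t. (norm (f t))\<^sup>2 / 2)" if "abs_continuous_on {s..b} f" for f :: "real \<Rightarrow> 'a"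
    using mult[OF inner[OF that that] const[of "1 / 2"]] by (simp add: power2_norm_eq_inner)
  show "abs_continuous_on {s..b} (P s z)"
    unfolding P_def Q_def by (rule abs_continuous_on_diff[OF Q n[OF xz]])
  have "abs_continuous_on {s..b} (\<lambda>t. t * (t + \<beta> * (\<alpha> - 2 - \<mu>)) * gap z t)"
    unfolding gap_def
    by (rule mult[OF mult[OF abs_continuous_on_id abs_continuous_on_add[OF abs_continuous_on_id const]]
          abs_continuous_on_diff[OF g const]])
  from abs_continuous_on_add[OF abs_continuous_on_add[OF this n[OF v]] mult[OF const[of "\<mu> * (\<alpha> - 1 - \<mu>)"] n[OF xz]]]
  show "abs_continuous_on {s..b} (energy \<mu> z)" unfolding energy_def by simp
qed

text \<open>The derivative is nonnegative off a null set, because the inner product of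
  \<open>x t - z\<close> with a subgradient dominates the gap.\<close>

lemma P_mono:
  assumes s: "t0 < s" "s \<notin> exceptional" and z: "z \<in> argmin_set \<phi>" and pr: "s \<le> p" "p \<le> r"
  shows "P s z p \<le> P s z r"
proof -
  have "- P s z r \<le> - P s z p"
  proof (rule abs_continuous_on_antimono[OF _ pr(2)])
    \<comment> \<open>\<open>s\<close> is added because \<open>P_derivative\<close> applies only to
      times after \<open>s\<close>.\<close>
    show "negligible (exceptional \<union> {s})" using negligible_exceptional by simp
    have "abs_continuous_on {p..r} (P s z)"
      by (rule abs_continuous_on_subset[OF abs_continuous_regular(4)[OF s, of r]]) (use pr in auto)
    from abs_continuous_on_diff[OF abs_continuous_on_const[of _ 0] this]
    show "abs_continuous_on {p..r} (\<lambda>t. - P s z t)" by simp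
    fix t assume t: "t \<in> {p..r} - (exceptional \<union> {s})"
    then have t': "t0 < t" "t \<notin> exceptional" "s < t" using s pr by auto
    obtain \<xi> where \<xi>: "\<xi> \<in> subdifferential \<phi> (x t)" "(x has_vector_derivative (u t - \<beta> *\<^sub>R \<xi>)) (at t)"
      using system_data[OF t'(1,2)] by blast
    have "((\<lambda>t. - P s z t) has_real_derivative - (\<beta> * ((x t - z) \<bullet> \<xi>))) (at t)"
      by (intro DERIV_minus P_derivative[OF s(1) t'(3) \<xi>(2) refl])
    moreover have "0 \<le> (x t - z) \<bullet> \<xi>"
      using gap_nonneg[OF s _ z, of t] gap_le_inner[OF \<xi>(1) z] t'(3) by simp
    ultimately show "\<exists>F d. (F has_real_derivative d) (at t) \<and> d \<le> 0 \<and> F t = - P s z t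
        \<and> (\<forall>s'\<in>{p..r}. F s' \<le> - P s z s')"
      using \<beta> by (intro exI[of _ "\<lambda>t. - P s z t"] exI[of _ "- (\<beta> * ((x t - z) \<bullet> \<xi>))"]) auto
  qed
  then show ?thesis by simp
qed

text \<open>In the minorant, \<open>g\<close> is replaced by its affine lower bound given by the subgradient at \<open>x t\<close>.\<close>

lemma energy_P_antimono:
  assumes s: "t0 < s" "s \<notin> exceptional" and z: "z \<in> argmin_set \<phi>" and \<mu>: "2 < \<mu>" "\<mu> < \<alpha> - 1"
    and p: "s \<le> p" "\<beta> \<le> p" "\<beta> * (\<alpha> - 1) \<le> (\<mu> - 2) * p" and "p \<le> r"
  shows "energy \<mu> z r + P s z r \<le> energy \<mu> z p + P s z p"
proof (rule abs_continuous_on_antimono[OF _ \<open>p \<le> r\<close>])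
  show "negligible (exceptional \<union> {s})" using negligible_exceptional by simp
  show "abs_continuous_on {p..r} (\<lambda>t. energy \<mu> z t + P s z t)"
    by (intro abs_continuous_on_add; rule abs_continuous_on_subset[OF abs_continuous_regular(4)[OF s, of r]]
        abs_continuous_on_subset[OF abs_continuous_regular(5)[OF s, of r]]; use p in auto)
  fix t assume t: "t \<in> {p..r} - (exceptional \<union> {s})"
  then have t': "t0 < t" "t \<notin> exceptional" "s < t" and "p \<le> t" using s p by auto
  obtain \<xi> where \<xi>: "\<xi> \<in> subdifferential \<phi> (x t)"
    and x': "(x has_vector_derivative (u t - \<beta> *\<^sub>R \<xi>)) (at t)"
    and y': "(y has_vector_derivative (u t + (\<alpha> * \<beta> / t\<^sup>2) *\<^sub>R x t)) (at t)"
    using system_data[OF t'(1,2)] by blast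
  define v where "v = u t - \<beta> *\<^sub>R \<xi>"
  define w where "w = x t - z"
  define \<kappa> where "\<kappa> = \<beta> * (\<alpha> - 2 - \<mu>)"
  define A where "A q = \<xi> \<bullet> (x q - x t)" for q
  define V where "V q = (norm (\<mu> *\<^sub>R (x q - z) + q *\<^sub>R u q))\<^sup>2" for q
  define W where "W q = (norm (x q - z))\<^sup>2" for q
  define F where "F q = q * (q + \<kappa>) * (gap z t + A q) + V q / 2 + \<mu> * (\<alpha> - 1 - \<mu>) / 2 * W q + P s z q" for q
  have ut: "u t = v + \<beta> *\<^sub>R \<xi>" by (simp add: v_def)
  have x'': "((\<lambda>q. x q - c) has_vector_derivative v) (at t)" for c
    using has_vector_derivative_diff[OF x' has_vector_derivative_const] by (simp add: v_def)
  have dA: "(A has_real_derivative \<xi> \<bullet> v) (at t)"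
    unfolding A_def has_real_derivative_iff_has_vector_derivative
    using bounded_bilinear.has_vector_derivative[OF bounded_bilinear_inner has_vector_derivative_const x''[of "x t"]] by simp
  have dW: "(W has_real_derivative 2 * (w \<bullet> v)) (at t)"
    unfolding W_def has_real_derivative_iff_has_vector_derivative power2_norm_eq_inner
    using bounded_bilinear.has_vector_derivative[OF bounded_bilinear_inner x''[of z] x''[of z]] by (simp add: w_def inner_commute)
  have "((\<lambda>q. \<mu> *\<^sub>R (x q - z) + q *\<^sub>R u q) has_vector_derivative
      (\<mu> *\<^sub>R v + 0 *\<^sub>R (x t - z)) + (t *\<^sub>R (- (\<alpha> / t) *\<^sub>R v - \<xi>) + 1 *\<^sub>R u t)) (at t)"
    by (intro has_vector_derivative_add has_vector_derivative_scaleR DERIV_const DERIV_ident x''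
        u_derivative[OF t'(1) x' refl y', folded v_def])
  also have "(\<mu> *\<^sub>R v + 0 *\<^sub>R (x t - z)) + (t *\<^sub>R (- (\<alpha> / t) *\<^sub>R v - \<xi>) + 1 *\<^sub>R u t)
      = (\<mu> + 1 - \<alpha>) *\<^sub>R v - (t - \<beta>) *\<^sub>R \<xi>"
    using t'(1) t0 by (simp add: ut algebra_simps)
  finally have d: "((\<lambda>q. \<mu> *\<^sub>R (x q - z) + q *\<^sub>R u q) has_vector_derivative
      (\<mu> + 1 - \<alpha>) *\<^sub>R v - (t - \<beta>) *\<^sub>R \<xi>) (at t)" .
  define V' where "V' = (\<mu> *\<^sub>R w + t *\<^sub>R (v + \<beta> *\<^sub>R \<xi>)) \<bullet> ((\<mu> + 1 - \<alpha>) *\<^sub>R v - (t - \<beta>) *\<^sub>R \<xi>)"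
  have dV: "(V has_real_derivative 2 * V') (at t)"
    unfolding V_def has_real_derivative_iff_has_vector_derivative power2_norm_eq_inner V'_def w_def ut[symmetric]
    using bounded_bilinear.has_vector_derivative[OF bounded_bilinear_inner d d] by (simp add: inner_commute)
  have dF: "(F has_real_derivative (2 * t + \<kappa>) * gap z t + t * (t + \<kappa>) * (\<xi> \<bullet> v) + V'
      + \<mu> * (\<alpha> - 1 - \<mu>) * (w \<bullet> v) + \<beta> * (w \<bullet> \<xi>)) (at t)" (is "(F has_real_derivative ?D) _")
    unfolding F_def
    by (rule DERIV_cong[OF DERIV_add[OF DERIV_add[OF DERIV_add[OF DERIV_mult[OF DERIV_mult[OF DERIV_ident
          DERIV_add[OF DERIV_ident DERIV_const]] DERIV_add[OF DERIV_const dA]] DERIV_cdivide[OF dV]]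
          DERIV_cmult[OF dW]] P_derivative[OF s(1) t'(3) x' refl, of z, folded w_def]]])
      (simp add: A_def algebra_simps add_divide_distrib diff_divide_distrib)
  \<comment> \<open>The weights in the energy are chosen for this expansion: its terms in
    \<open>w \<bullet> v\<close> and \<open>\<xi> \<bullet> v\<close> cancel those coming from the
    squared distance and from the gap.\<close>
  have "V' = - (\<mu> * (\<alpha> - 1 - \<mu>) * (w \<bullet> v)) - \<mu> * (t - \<beta>) * (w \<bullet> \<xi>) - (\<alpha> - 1 - \<mu>) * t * (v \<bullet> v)
      - t * (t + \<kappa>) * (\<xi> \<bullet> v) - \<beta> * t * (t - \<beta>) * (\<xi> \<bullet> \<xi>)"
    unfolding V'_def \<kappa>_def
    by (simp add: inner_add_left inner_add_right inner_diff_right inner_diff_left inner_commute algebra_simps)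
  then have "?D = (2 * t + \<kappa>) * gap z t - \<mu> * (t - \<beta>) * (w \<bullet> \<xi>) + \<beta> * (w \<bullet> \<xi>)
      - (\<alpha> - 1 - \<mu>) * t * (v \<bullet> v) - \<beta> * t * (t - \<beta>) * (\<xi> \<bullet> \<xi>)"
    by simp
  \<comment> \<open>The discarded terms are squared norms with nonnegative weights, by
    \<open>\<mu> < \<alpha> - 1\<close> and \<open>\<beta> \<le> t\<close>.\<close>
  also have "\<dots> \<le> (2 * t + \<kappa>) * gap z t - \<mu> * (t - \<beta>) * (w \<bullet> \<xi>) + \<beta> * (w \<bullet> \<xi>)"
  proof -
    have "0 \<le> (\<alpha> - 1 - \<mu>) * t * (v \<bullet> v)" "0 \<le> \<beta> * t * (t - \<beta>) * (\<xi> \<bullet> \<xi>)"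
      using \<mu> \<beta> t0 t'(1) \<open>p \<le> t\<close> p by auto
    then show ?thesis by simp
  qed
  also have "\<dots> \<le> (2 * t + \<kappa>) * (w \<bullet> \<xi>) - \<mu> * (t - \<beta>) * (w \<bullet> \<xi>) + \<beta> * (w \<bullet> \<xi>)"
  proof -
    have "- \<beta> \<le> \<kappa>" using mult_left_mono[of "-1" "\<alpha> - 2 - \<mu>" \<beta>] \<mu> \<beta> by (simp add: \<kappa>_def)
    then have "0 \<le> 2 * t + \<kappa>" using p \<open>p \<le> t\<close> \<beta> by linarith
    then show ?thesis using gap_le_inner[OF \<xi> z] by (simp add: w_def mult_left_mono)
  qed
  \<comment> \<open>The coefficient includes the contribution \<beta> of \<open>P\<close>. It
    decreases in \<open>t\<close> because \<open>\<mu> > 2\<close>, and the last condition on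
    \<open>p\<close> says that it is nonpositive at \<open>p\<close>.\<close>
  also have "\<dots> = (\<beta> * (\<alpha> - 1) - (\<mu> - 2) * t) * (w \<bullet> \<xi>)" by (simp add: \<kappa>_def algebra_simps)
  also have "\<dots> \<le> 0"
  proof (rule mult_nonpos_nonneg)
    have "(\<mu> - 2) * p \<le> (\<mu> - 2) * t" using \<mu> \<open>p \<le> t\<close> by simp
    then show "\<beta> * (\<alpha> - 1) - (\<mu> - 2) * t \<le> 0" using p by linarith
    show "0 \<le> w \<bullet> \<xi>"
      using gap_nonneg[OF s _ z, of t] gap_le_inner[OF \<xi> z] t'(3) by (simp add: w_def)
  qed
  finally have "?D \<le> 0" .
  moreover have "F t = energy \<mu> z t + P s z t"
    by (simp add: F_def energy_def A_def V_def W_def \<kappa>_def)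
  moreover have "F q \<le> energy \<mu> z q + P s z q" if q: "q \<in> {p..r}" for q
  proof -
    have "\<phi> (x q) = ereal (g q)" "\<phi> (x t) = ereal (g t)"
      using q t p by (auto intro!: g_finite[OF s])
    moreover have "\<phi> (x t) + ereal (A q) \<le> \<phi> (x q)" using \<xi> by (simp add: subdifferential_def A_def)
    ultimately have "gap z t + A q \<le> gap z q" by (simp add: gap_def)
    moreover have "0 \<le> q * (q + \<kappa>)"
    proof (rule mult_nonneg_nonneg)
      have "- \<beta> \<le> \<kappa>" using mult_left_mono[of "-1" "\<alpha> - 2 - \<mu>" \<beta>] \<mu> \<beta> by (simp add: \<kappa>_def)
      then show "0 \<le> q + \<kappa>" using q p by auto
      show "0 \<le> q" using q p \<beta> by auto
    qed
    ultimately show ?thesis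
      by (simp add: F_def energy_def V_def W_def \<kappa>_def mult_left_mono)
  qed
  ultimately show "\<exists>F d. (F has_real_derivative d) (at t) \<and> d \<le> 0 \<and> F t = energy \<mu> z t + P s z t \<and>
      (\<forall>q\<in>{p..r}. F q \<le> energy \<mu> z q + P s z q)"
    using dF by blast
qed

text \<open>The two terms in \<open>\<mu>\<^sup>2\<close>, one from the mixed norm and one from the
  last weight, cancel. The slope in \<mu> is thus accessible from two energies.\<close>

lemma energy_affine:
  "energy \<mu> z t = energy 0 z t + \<mu> * (t * ((x t - z) \<bullet> u t) + (\<alpha> - 1) / 2 * (norm (x t - z))\<^sup>2 - \<beta> * t * gap z t)"
proof -
  have "(norm (\<mu> *\<^sub>R (x t - z) + t *\<^sub>R u t))\<^sup>2 =
      \<mu>\<^sup>2 * (norm (x t - z))\<^sup>2 + 2 * \<mu> * t * ((x t - z) \<bullet> u t) + (norm (t *\<^sub>R u t))\<^sup>2"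
    unfolding power2_norm_eq_inner
    by (simp only: inner_add_left inner_add_right inner_scaleR_left inner_scaleR_right inner_commute[of "u t" "x t - z"])
      (simp add: algebra_simps power2_eq_square)
  then show ?thesis unfolding energy_def by (simp add: field_simps power2_eq_square)
qed

section \<open>Limits along the trajectory and the weak limit\<close>

lemma gap_and_norm_converge:
  assumes z: "z \<in> argmin_set \<phi>"
  shows "(gap z \<longlongrightarrow> 0) at_top" and "\<exists>l. ((\<lambda>t. (norm (x t - z))\<^sup>2) \<longlongrightarrow> l) at_top"
proof -
  obtain s where s: "t0 < s" "s \<notin> exceptional" using good_between[of t0 "t0 + 1"] by auto
  \<comment> \<open>Two distinct admissible values, at one third and two thirds of the way from 2 to
    \<open>\<alpha> - 1\<close>; the interval is nonempty because
    \<open>\<alpha> > 3\<close>.\<close>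
  define \<mu>\<^sub>1 where "\<mu>\<^sub>1 = 2 + (\<alpha> - 3) / 3"
  define \<mu>\<^sub>2 where "\<mu>\<^sub>2 = 2 + 2 * (\<alpha> - 3) / 3"
  have \<mu>: "2 < \<mu>\<^sub>1" "\<mu>\<^sub>1 < \<mu>\<^sub>2" "\<mu>\<^sub>2 < \<alpha> - 1" using \<alpha> by (auto simp: \<mu>\<^sub>1_def \<mu>\<^sub>2_def field_simps)
  \<comment> \<open>\<open>2 * \<beta>\<close> makes the weight of the gap at least
    \<open>t / 2\<close>, 1 gives \<open>gap z t \<le> t * gap z t\<close>, and the last entry is
    the threshold of \<open>energy_P_antimono\<close> for \<open>\<mu>\<^sub>1\<close>, which also
    serves larger \<mu>.\<close>
  define T where "T = max (max s 1) (max (2 * \<beta>) (\<beta> * (\<alpha> - 1) / (\<mu>\<^sub>1 - 2)))"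
  have T: "s \<le> T" "1 \<le> T" "2 * \<beta> \<le> T" "\<beta> * (\<alpha> - 1) / (\<mu>\<^sub>1 - 2) \<le> T" by (auto simp: T_def)
  define G where "G \<mu> t = energy \<mu> z t + P s z t" for \<mu> t
  have gap0: "0 \<le> gap z t" if "T \<le> t" for t using gap_nonneg[OF s _ z, of t] that T by simp
  have weight: "t / 2 \<le> t + \<beta> * (\<alpha> - 2 - \<mu>)" if "T \<le> t" "\<mu> < \<alpha> - 1" for t \<mu>
    using mult_left_mono[of "-1" "\<alpha> - 2 - \<mu>" \<beta>] that T \<beta> by simp
  have energy_ge: "t\<^sup>2 / 2 * gap z t \<le> energy \<mu> z t" if t: "T \<le> t" and "2 < \<mu>" "\<mu> < \<alpha> - 1" for \<mu> t
  proof -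
    have "t\<^sup>2 / 2 * gap z t = t * (t / 2) * gap z t" by (simp add: power2_eq_square)
    also have "\<dots> \<le> t * (t + \<beta> * (\<alpha> - 2 - \<mu>)) * gap z t"
      using weight[OF t] that gap0[OF t] T by (intro mult_right_mono mult_left_mono) auto
    also have "\<dots> \<le> energy \<mu> z t"
      unfolding energy_def using that by simp
    finally show ?thesis .
  qed
  have energy_nonneg: "0 \<le> energy \<mu> z t" if "T \<le> t" "2 < \<mu>" "\<mu> < \<alpha> - 1" for \<mu> t
    by (rule order_trans[OF _ energy_ge[OF that]]) (use gap0[OF that(1)] in simp)
  have G_anti: "G \<mu> r \<le> G \<mu> p" if "T \<le> p" "p \<le> r" "\<mu>\<^sub>1 \<le> \<mu>" "\<mu> < \<alpha> - 1" for \<mu> p r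
    unfolding G_def
  proof (rule energy_P_antimono[OF s z])
    have "\<beta> * (\<alpha> - 1) \<le> (\<mu>\<^sub>1 - 2) * T"
      using T(4) \<mu>(1) by (simp add: pos_divide_le_eq mult.commute)
    also have "\<dots> \<le> (\<mu>\<^sub>1 - 2) * p" using that(1) \<mu>(1) by simp
    also have "\<dots> \<le> (\<mu> - 2) * p" using that T by (intro mult_right_mono) auto
    finally show "\<beta> * (\<alpha> - 1) \<le> (\<mu> - 2) * p" .
  qed (use that T \<mu> \<beta> in auto)
  have P_ge: "P s z T \<le> P s z t" if "T \<le> t" for t
    by (rule P_mono[OF s z T(1) that])
  \<comment> \<open>The energy is nonnegative, so the decrease of \<open>G\<close> bounds
    \<open>P\<close> from above. The nondecreasing \<open>P\<close> then converges, and subtracting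
    it from \<open>G\<close> makes the energy converge.\<close>
  have P_le: "P s z t \<le> G \<mu>\<^sub>1 T" if "T \<le> t" for t
    using G_anti[of T t \<mu>\<^sub>1] energy_nonneg[OF that, of \<mu>\<^sub>1] that \<mu> unfolding G_def by simp
  have "\<exists>l. ((\<lambda>t. - P s z t) \<longlongrightarrow> l) at_top"
    by (rule antimono_bounded_tendsto_at_top[where a = T and c = "- G \<mu>\<^sub>1 T"])
      (use P_le P_mono[OF s z] T in auto)
  then obtain p where "((\<lambda>t. - P s z t) \<longlongrightarrow> p) at_top" by blast
  from tendsto_minus[OF this] have P_lim: "(P s z \<longlongrightarrow> - p) at_top" by simp
  have energy_lim: "\<exists>l. (energy \<mu> z \<longlongrightarrow> l) at_top" if m: "\<mu>\<^sub>1 \<le> \<mu>" "\<mu> < \<alpha> - 1" for \<mu>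
  proof -
    have "P s z T \<le> G \<mu> t" if "T \<le> t" for t
      using P_ge[OF that] energy_nonneg[OF that, of \<mu>] m \<mu> unfolding G_def by simp
    then have "\<exists>l. (G \<mu> \<longlongrightarrow> l) at_top"
      using G_anti m by (intro antimono_bounded_tendsto_at_top[where a = T and c = "P s z T"]) auto
    then obtain l where "(G \<mu> \<longlongrightarrow> l) at_top" by blast
    from tendsto_diff[OF this P_lim] have "(energy \<mu> z \<longlongrightarrow> l - - p) at_top" by (simp add: G_def)
    then show ?thesis by (rule exI)
  qed
  obtain e1 where e1: "(energy \<mu>\<^sub>1 z \<longlongrightarrow> e1) at_top" using energy_lim[of \<mu>\<^sub>1] \<mu> by auto
  obtain e2 where e2: "(energy \<mu>\<^sub>2 z \<longlongrightarrow> e2) at_top" using energy_lim[of \<mu>\<^sub>2] \<mu> by auto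
  \<comment> \<open>The slope of the energy in \<mu>, so its limit is the difference quotient of the
    two limits \<open>e1\<close> and \<open>e2\<close>.\<close>
  define k where "k t = t * ((x t - z) \<bullet> u t) + (\<alpha> - 1) / 2 * (norm (x t - z))\<^sup>2 - \<beta> * t * gap z t" for t
  have "((\<lambda>t. (energy \<mu>\<^sub>2 z t - energy \<mu>\<^sub>1 z t) / (\<mu>\<^sub>2 - \<mu>\<^sub>1)) \<longlongrightarrow> (e2 - e1) / (\<mu>\<^sub>2 - \<mu>\<^sub>1)) at_top"
    using \<mu> by (intro tendsto_divide tendsto_diff e1 e2 tendsto_const) auto
  moreover have "(energy \<mu>\<^sub>2 z t - energy \<mu>\<^sub>1 z t) / (\<mu>\<^sub>2 - \<mu>\<^sub>1) = k t" for t
  proof -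
    have "energy \<mu>\<^sub>2 z t - energy \<mu>\<^sub>1 z t = (\<mu>\<^sub>2 - \<mu>\<^sub>1) * k t"
      unfolding energy_affine[of \<mu>\<^sub>1] energy_affine[of \<mu>\<^sub>2] k_def[symmetric] by (simp add: left_diff_distrib)
    then show ?thesis using \<mu> by simp
  qed
  ultimately have k_lim: "(k \<longlongrightarrow> (e2 - e1) / (\<mu>\<^sub>2 - \<mu>\<^sub>1)) at_top" by simp
  \<comment> \<open>\<open>B\<close> bounds the energy for \<open>\<mu>\<^sub>1\<close> after
    \<open>T\<close>, so the gap is at most \<open>2 * B / t\<^sup>2\<close>.\<close>
  define B where "B = G \<mu>\<^sub>1 T - P s z T"
  have tgap_le: "t * gap z t \<le> 2 * B / t" if t: "T \<le> t" for t
  proof -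
    have "t\<^sup>2 / 2 * gap z t \<le> B"
      using energy_ge[OF t, of \<mu>\<^sub>1] G_anti[of T t \<mu>\<^sub>1] P_ge[OF t] t \<mu> unfolding B_def G_def by simp
    then show ?thesis using t T by (simp add: field_simps power2_eq_square)
  qed
  have tgap_lim: "((\<lambda>t. t * gap z t) \<longlongrightarrow> 0) at_top"
  proof (rule tendsto_sandwich[OF _ _ tendsto_const])
    show "\<forall>\<^sub>F t in at_top. 0 \<le> t * gap z t"
      using eventually_ge_at_top[of T] by eventually_elim (use gap0 T in auto)
    show "\<forall>\<^sub>F t in at_top. t * gap z t \<le> 2 * B / t"
      using eventually_ge_at_top[of T] by eventually_elim (rule tgap_le)
    show "((\<lambda>t. 2 * B / t) \<longlongrightarrow> 0) at_top"
      by (rule tendsto_divide_0[OF tendsto_const filterlim_at_top_imp_at_infinity[OF filterlim_ident]])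
  qed
  show "(gap z \<longlongrightarrow> 0) at_top"
  proof (rule tendsto_sandwich[OF _ _ tendsto_const tgap_lim])
    show "\<forall>\<^sub>F t in at_top. 0 \<le> gap z t"
      using eventually_ge_at_top[of T] by eventually_elim (rule gap0)
    show "\<forall>\<^sub>F t in at_top. gap z t \<le> t * gap z t"
      using eventually_ge_at_top[of T]
    proof eventually_elim
      case (elim t)
      then show ?case using mult_right_mono[of 1 t "gap z t"] gap0[OF elim] T by simp
    qed
  qed
  define c where "c = \<alpha> - 1"
  have c: "c > 0" using \<alpha> by (simp add: c_def)
  \<comment> \<open>Adding \<beta> times \<open>t * gap z t\<close> and \<open>c\<close> times
    \<open>P\<close> to \<open>k\<close> cancels the gap and the squared norm;
    \<open>t * Q' + c * Q\<close> is left.\<close>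
  define L where "L = (e2 - e1) / (\<mu>\<^sub>2 - \<mu>\<^sub>1) + \<beta> * 0 + c * (- p)"
  have "((\<lambda>t. k t + \<beta> * (t * gap z t) + c * P s z t) \<longlongrightarrow> L) at_top"
    unfolding L_def by (rule tendsto_add[OF tendsto_add[OF k_lim tendsto_mult[OF tendsto_const tgap_lim]]
      tendsto_mult[OF tendsto_const P_lim]])
  moreover have "k t + \<beta> * (t * gap z t) + c * P s z t = t * ((x t - z) \<bullet> u t) + c * Q s z t" for t
    by (simp add: k_def P_def c_def algebra_simps diff_divide_distrib)
  ultimately have "((\<lambda>t. t * ((x t - z) \<bullet> u t) + c * Q s z t) \<longlongrightarrow> L) at_top" by simp
  then have "((\<lambda>t. (t * ((x t - z) \<bullet> u t) + c * Q s z t) / c) \<longlongrightarrow> L / c) at_top"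
    by (rule tendsto_divide) (use c in auto)
  \<comment> \<open>The right-hand side is the quotient of the derivatives of
    \<open>t powr c * Q s z t\<close> and \<open>t powr c\<close>, as l'Hospital's rule
    requires.\<close>
  moreover have "\<forall>\<^sub>F t in at_top. (t * ((x t - z) \<bullet> u t) + c * Q s z t) / c =
      (t powr c * ((x t - z) \<bullet> u t) + c * t powr (c - 1) * Q s z t) / (c * t powr (c - 1))"
    using eventually_ge_at_top[of T]
  proof eventually_elim
    case (elim t)
    then have t: "t > 0" using T by simp
    then have "t powr c = t * t powr (c - 1)" by (simp add: powr_mult_base)
    then show ?case using t c by (simp add: field_simps)
  qed
  ultimately have quot: "((\<lambda>t. (t powr c * ((x t - z) \<bullet> u t) + c * t powr (c - 1) * Q s z t) / (c * t powr (c - 1)))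
      \<longlongrightarrow> L / c) at_top"
    by (rule Lim_transform_eventually)
  have "((\<lambda>t. t powr c * Q s z t / t powr c) \<longlongrightarrow> L / c) at_top"
  proof (rule lhospital_at_top_at_top[OF _ _ _ _ quot])
    show "filterlim (\<lambda>t. t powr c) at_top at_top" using c by (rule filterlim_powr_at_top)
    show "\<forall>\<^sub>F t in at_top. c * t powr (c - 1) \<noteq> 0"
      using eventually_gt_at_top[of 0] by eventually_elim (use c in simp)
    show "\<forall>\<^sub>F t in at_top. ((\<lambda>t. t powr c) has_real_derivative c * t powr (c - 1)) (at t)"
      using eventually_gt_at_top[of 0] by eventually_elim (rule has_real_derivative_powr)
    show "\<forall>\<^sub>F t in at_top. ((\<lambda>t. t powr c * Q s z t) has_real_derivative
        t powr c * ((x t - z) \<bullet> u t) + c * t powr (c - 1) * Q s z t) (at t)"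
      using eventually_gt_at_top[of s]
    proof eventually_elim
      case (elim t)
      then have "t > 0" using s t0 by simp
      from DERIV_mult[OF has_real_derivative_powr[OF this, of c] Q_derivative[OF s(1) elim, of z]]
      show ?case by (simp add: algebra_simps)
    qed
  qed
  moreover have "\<forall>\<^sub>F t in at_top. t powr c * Q s z t / t powr c = Q s z t"
    using eventually_gt_at_top[of 0] by eventually_elim simp
  ultimately have "(Q s z \<longlongrightarrow> L / c) at_top" by (rule Lim_transform_eventually)
  from tendsto_mult[OF tendsto_const[of 2] tendsto_diff[OF this P_lim]]
  have "((\<lambda>t. (norm (x t - z))\<^sup>2) \<longlongrightarrow> 2 * (L / c - - p)) at_top" by (simp add: P_def)
  then show "\<exists>l. ((\<lambda>t. (norm (x t - z))\<^sup>2) \<longlongrightarrow> l) at_top" by (rule exI)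
qed

text \<open>Since the gap tends to 0, late tails lie in a sublevel set slightly above the minimum.
  That set is closed and convex, so it contains the hulls and hence \<open>w\<close>.\<close>

lemma tail_hulls_in_argmin:
  assumes z: "z \<in> argmin_set \<phi>" and w: "\<And>T. w \<in> closure (convex hull (x ` {T..}))"
  shows "w \<in> argmin_set \<phi>"
proof -
  obtain s where s: "t0 < s" "s \<notin> exceptional" using good_between[of t0 "t0 + 1"] by auto
  have "\<phi> w \<le> \<phi> z"
  proof (rule ereal_le_epsilon2)
    fix e :: real assume "e > 0"
    then have "\<forall>\<^sub>F t in at_top. gap z t < e"
      by (intro order_tendstoD(2)[OF gap_and_norm_converge(1)[OF z]])
    then obtain T where T: "\<forall>t\<ge>T. gap z t < e" unfolding eventually_at_top_linorder by blast
    define c where "c = real_of_ereal (\<phi> z) + e"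
    have "x ` {max s T..} \<subseteq> {p. \<phi> p \<le> ereal c}"
    proof (rule image_subsetI)
      fix t assume "t \<in> {max s T..}"
      then have t: "s \<le> t" "T \<le> t" by auto
      have "gap z t < e" using T t(2) by blast
      then show "x t \<in> {p. \<phi> p \<le> ereal c}" using g_finite[OF s t(1)] by (simp add: c_def gap_def)
    qed
    then have "closure (convex hull (x ` {max s T..})) \<subseteq> {p. \<phi> p \<le> ereal c}"
      by (intro closure_minimal hull_minimal lsc_closed_sublevel[OF lsc] econvex_convex_sublevel[OF convex])
    then have "\<phi> w \<le> ereal c" using w[of "max s T"] by blast
    also have "ereal c = ereal (real_of_ereal (\<phi> z)) + ereal e" by (simp add: c_def)
    also have "\<dots> = \<phi> z + ereal e" unfolding argmin_finite(1)[OF z, symmetric] ..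
    finally show "\<phi> w \<le> \<phi> z + ereal e" .
  qed
  then have "\<phi> w \<le> \<phi> q" for q using argmin_finite(2)[OF z] by (rule order_trans)
  then show ?thesis by (simp add: argmin_set_def is_arg_min_def not_less)
qed

lemma weak_convergence:
  assumes "argmin_set \<phi> \<noteq> {}"
  shows "\<exists>z\<in>argmin_set \<phi>. weakly_tendsto x z at_top"
proof (rule opial[OF assms])
  fix z assume "z \<in> argmin_set \<phi>"
  then show "\<exists>l. ((\<lambda>t. (norm (x t - z))\<^sup>2) \<longlongrightarrow> l) at_top" by (rule gap_and_norm_converge(2))
next
  fix w assume w: "\<And>T. w \<in> closure (convex hull (x ` {T..}))"
  obtain z where "z \<in> argmin_set \<phi>" using assms by blast
  then show "w \<in> argmin_set \<phi>" using w by (rule tail_hulls_in_argmin)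
qed

end

theorem theorem4p11:
  fixes \<phi> :: "'a::{real_inner, complete_space} \<Rightarrow> ereal"
    and \<alpha> \<beta> t0 :: real
    and x y :: "real \<Rightarrow> 'a"
    and x0 y0 :: 'a
  assumes "proper \<phi>" and "lsc \<phi>" and "econvex \<phi>"
    and "argmin_set \<phi> \<noteq> {}"
    and "\<alpha> > 3" and "\<beta> > 0" and "t0 > 0"
    and "global_strong_solution \<phi> \<alpha> \<beta> t0 x y"
    and "x0 \<in> edom \<phi>"
    and "x t0 = x0" and "y t0 = y0"
  shows "\<exists>z\<in>argmin_set \<phi>. weakly_tendsto x z at_top"
proof -
  interpret strong_solution \<phi> \<alpha> \<beta> t0 x y
    using assms by unfold_locales
  show ?thesis by (rule weak_convergence) fact
qed

end
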